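(* Let $\alpha$ be a snowy weak composition, and take positive integers $m,n$ with $\mathsf{supp}(\alpha)\subseteq[n]$ and $m\ge\max(\alpha)$. Let $w=\mathsf{std}_{m,n}(\alpha)$. Then $r_{m,n}(\widehat{\mathfrak{L}}_\alpha)=\mathfrak{S}_w$.
   Context: A weak composition is an infinite sequence $\alpha=(\alpha_1,\alpha_2,\dots)$ of non-negative integers with finitely many positive entries; $\mathsf{supp}(\alpha)=\{i:\alpha_i>0\}$; $x^\alpha=\prod_i x_i^{\alpha_i}$; $\alpha$ is a partition if it is weakly decreasing; $\alpha$ is snowy if its positive entries are pairwise distinct; $s_i\alpha$ swaps entries $i$ and $i+1$. For $\alpha$ with $\mathsf{supp}(\alpha)\subseteq[n]$ and all $\alpha_i\le m$, set $r_{m,n}(\alpha)=(m-\alpha_n,\dots,m-\alpha_1)$. For a polynomial $f\in\mathbb{Q}[x_1,\dots,x_n]$ with each variable of exponent at most $m$, $r_{m,n}(f)=x_1^m\cdots x_n^m f(x_n^{-1},\dots,x_1^{-1})$. Operators: $\partial_i(f)=\frac{f-s_if}{x_i-x_{i+1}}$ (where $s_i$ swaps $x_i,x_{i+1}$), $\widehat{\pi}_i(f)=x_ix_{i+1}\partial_i(f)$. Top Lascoux polynomials for snowy $\alpha$: $\widehat{\mathfrak{L}}_\alpha=x^\alpha$ if $\alpha$ is a partition, and $\widehat{\mathfrak{L}}_\alpha=\widehat{\pi}_i(\widehat{\mathfrak{L}}_{s_i\alpha})$ if $\alpha_i<\alpha_{i+1}$ (this is well defined). Schubert polynomials: for $w$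 a permutation of $\{1,2,\dots\}$ fixing all but finitely many elements, $\mathsf{invcode}(w)_i=|\{j>i:w(j)<w(i)\}|$; $w$ is dominant if $\mathsf{invcode}(w)$ is a partition; $\mathfrak{S}_w=x^{\mathsf{invcode}(w)}$ if $w$ is dominant, and $\mathfrak{S}_w=\partial_i(\mathfrak{S}_{ws_i})$ if $w(i)<w(i+1)$. Standardization: for snowy $\alpha$ with $\mathsf{supp}(\alpha)\subseteq[n]$ and $m\ge\max(\alpha)$, let $\beta=r_{m+1,n}(\alpha)$; $\mathsf{std}_{m,n}(\alpha)$ is the unique permutation $w$ with $w(n+1)<w(n+2)<\cdots$ and, for $i\in[n]$, $w(i)=\beta_i$ if $\beta_i\le m$, and $w(i)=m+|\{j\in[i]:\beta_j=m+1\}|$ if $\beta_i=m+1$. *)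

theory Defs
  imports
    Complex_Main
    "HOL-Library.Poly_Mapping"
    "HOL-Computational_Algebra.Fraction_Field"
    "HOL-Combinatorics.Permutations"
begin

text \<open>
  All indices start at 1, as in the mathematical text.  A weak composition is a finitely supported
  function \<open>\<alpha> :: nat \<Rightarrow>\<^sub>0 nat\<close> with \<open>0 \<notin> keys \<alpha>\<close>, so \<open>supp(\<alpha>)\<close> is \<open>keys \<alpha>\<close>, and a permutation
  of \<open>{1, 2, \<dots>}\<close> is a function \<open>nat \<Rightarrow> nat\<close> that fixes the unused index 0.
\<close>

text \<open>Polynomials over the rationals, as finitely supported functions from exponent vectors to
  coefficients; multiplication is convolution.\<close>

type_synonym qpoly = "(nat \<Rightarrow>\<^sub>0 nat) \<Rightarrow>\<^sub>0 rat"

definition const :: "rat \<Rightarrow> qpoly" where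
  "const c = Poly_Mapping.single 0 c"

definition mon :: "(nat \<Rightarrow>\<^sub>0 nat) \<Rightarrow> qpoly" where
  "mon \<alpha> = Poly_Mapping.single \<alpha> 1"

definition var :: "nat \<Rightarrow> qpoly" where
  "var i = mon (Poly_Mapping.single i 1)"

text \<open>Substitution of \<open>\<phi> i\<close> for the \<open>i\<close>-th variable in a ring \<open>'r\<close> into which the rationals are
  mapped by \<open>h\<close>.\<close>

definition substitute :: "(rat \<Rightarrow> 'r::comm_ring_1) \<Rightarrow> (nat \<Rightarrow> 'r) \<Rightarrow> qpoly \<Rightarrow> 'r" where
  "substitute h \<phi> f = (\<Sum>a\<in>Poly_Mapping.keys f. h (Poly_Mapping.lookup f a) *
                    (\<Prod>i\<in>Poly_Mapping.keys a. \<phi> i ^ Poly_Mapping.lookup a i))"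

definition to_fract :: "qpoly \<Rightarrow> qpoly fract" where
  "to_fract f = Fract f 1"

lemma to_fract_inject: "to_fract f = to_fract g \<longleftrightarrow> f = g"
  by (simp add: to_fract_def eq_fract)


definition is_partition :: "(nat \<Rightarrow>\<^sub>0 nat) \<Rightarrow> bool" where
  "is_partition \<alpha> \<longleftrightarrow> (\<forall>i\<ge>1. Poly_Mapping.lookup \<alpha> (i + 1) \<le> Poly_Mapping.lookup \<alpha> i)"

definition snowy :: "(nat \<Rightarrow>\<^sub>0 nat) \<Rightarrow> bool" where
  "snowy \<alpha> \<longleftrightarrow> inj_on (Poly_Mapping.lookup \<alpha>) (Poly_Mapping.keys \<alpha>)"

definition swap_comp :: "nat \<Rightarrow> (nat \<Rightarrow>\<^sub>0 nat) \<Rightarrow> (nat \<Rightarrow>\<^sub>0 nat)" where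
  "swap_comp i \<alpha> = Poly_Mapping.map_key (transpose i (i + 1)) \<alpha>"

lemma lookup_swap_comp:
  "Poly_Mapping.lookup (swap_comp i \<alpha>) j = Poly_Mapping.lookup \<alpha> (transpose i (i + 1) j)"
  by (simp add: swap_comp_def Poly_Mapping.map_key.rep_eq)

lift_definition rev_comp :: "nat \<Rightarrow> nat \<Rightarrow> (nat \<Rightarrow>\<^sub>0 nat) \<Rightarrow> (nat \<Rightarrow>\<^sub>0 nat)" is
  "\<lambda>m n \<alpha> i. if i \<in> {1..n} then m - \<alpha> (n + 1 - i) else 0"
  by simp

text \<open>The identity defining \<open>r\<^bsub>m,n\<^esub>(f)\<close> is read in the field of rational functions; for \<open>f\<close> in the
  variables 1 to \<open>n\<close>, with exponents at most \<open>m\<close>, its value there is a (unique) polynomial.\<close>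

definition rev_poly :: "nat \<Rightarrow> nat \<Rightarrow> qpoly \<Rightarrow> qpoly" where
  "rev_poly m n f = (THE g. to_fract g =
     (\<Prod>i\<in>{1..n}. to_fract (var i) ^ m) *
     substitute (\<lambda>c. to_fract (const c)) (\<lambda>i. inverse (to_fract (var (n + 1 - i)))) f)"


definition swap_poly :: "nat \<Rightarrow> qpoly \<Rightarrow> qpoly" where
  "swap_poly i f = substitute const (\<lambda>j. var (transpose i (i + 1) j)) f"

definition divdiff :: "nat \<Rightarrow> qpoly \<Rightarrow> qpoly" where
  "divdiff i f = (THE g. (var i - var (i + 1)) * g = f - swap_poly i f)"

lemma var_diff_nonzero: "var i - var (i + 1) \<noteq> 0"
proof
  assume "var i - var (i + 1) = 0"
  then have "var i = var (i + 1)" by simp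
  then have "Poly_Mapping.lookup (var i) (Poly_Mapping.single i 1)
      = Poly_Mapping.lookup (var (i + 1)) (Poly_Mapping.single i 1)" by simp
  moreover have "Poly_Mapping.single (Suc i) (1::nat) \<noteq> Poly_Mapping.single i 1"
    by (metis lookup_single_eq lookup_single_not_eq n_not_Suc_n one_neq_zero)
  ultimately show False
    by (simp add: var_def mon_def lookup_single)
qed

lemma divdiff_eqI: "(var i - var (i + 1)) * g = f - swap_poly i f \<Longrightarrow> divdiff i f = g"
  unfolding divdiff_def using var_diff_nonzero[of i]
  by (metis (mono_tags, lifting) mult_left_cancel the_equality)

definition pihat :: "nat \<Rightarrow> qpoly \<Rightarrow> qpoly" where
  "pihat i f = var i * var (i + 1) * divdiff i f"


text \<open>\<open>is_top_lascoux \<alpha> f\<close>: the defining rules allow one to compute \<open>f\<close> as the top Lascoux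
  polynomial of \<open>\<alpha>\<close>.  The result does not depend on the choices of \<open>i\<close>, so \<open>f\<close> is
  determined by \<open>\<alpha>\<close>; likewise for \<open>is_schubert\<close> below.\<close>

inductive is_top_lascoux :: "(nat \<Rightarrow>\<^sub>0 nat) \<Rightarrow> qpoly \<Rightarrow> bool" where
  partition: "is_top_lascoux \<alpha> (mon \<alpha>)"
    if "0 \<notin> Poly_Mapping.keys \<alpha>" "snowy \<alpha>" "is_partition \<alpha>"
| ascent: "is_top_lascoux \<alpha> (pihat i f)"
    if "i \<ge> 1" "Poly_Mapping.lookup \<alpha> i < Poly_Mapping.lookup \<alpha> (i + 1)"
      "is_top_lascoux (swap_comp i \<alpha>) f"

definition top_lascoux :: "(nat \<Rightarrow>\<^sub>0 nat) \<Rightarrow> qpoly" where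
  "top_lascoux \<alpha> = (THE f. is_top_lascoux \<alpha> f)"


definition fin_perm :: "(nat \<Rightarrow> nat) \<Rightarrow> bool" where
  "fin_perm w \<longleftrightarrow> w permutes {1..} \<and> finite {i. w i \<noteq> i}"

definition invcode :: "(nat \<Rightarrow> nat) \<Rightarrow> (nat \<Rightarrow>\<^sub>0 nat)" where
  "invcode w = Abs_poly_mapping (\<lambda>i. card {j. i < j \<and> w j < w i})"

lemma lookup_invcode:
  assumes "fin_perm w"
  shows "Poly_Mapping.lookup (invcode w) i = card {j. i < j \<and> w j < w i}"
proof -
  obtain N where N: "\<And>i. w i \<noteq> i \<Longrightarrow> i < N"
    using assms unfolding fin_perm_def
    by (metis (mono_tags, lifting) finite_nat_set_iff_bounded mem_Collect_eq)
  have "card {j. i < j \<and> w j < w i} = 0" if "i \<ge> N" for i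
  proof -
    have "{j. i < j \<and> w j < w i} = {}"
      using N that by (auto dest: leD) (metis leD le_trans less_imp_le not_less_iff_gr_or_eq)
    then show ?thesis by (metis card.empty)
  qed
  then have "{i. card {j. i < j \<and> w j < w i} \<noteq> 0} \<subseteq> {..<N}"
    by (metis (mono_tags, lifting) lessThan_iff linorder_not_less mem_Collect_eq subsetI)
  then have "finite {i. card {j. i < j \<and> w j < w i} \<noteq> 0}"
    using finite_lessThan finite_subset by blast
  then show ?thesis
    unfolding invcode_def by (subst lookup_Abs_poly_mapping) auto
qed

definition dominant :: "(nat \<Rightarrow> nat) \<Rightarrow> bool" where
  "dominant w \<longleftrightarrow> is_partition (invcode w)"

inductive is_schubert :: "(nat \<Rightarrow> nat) \<Rightarrow> qpoly \<Rightarrow> bool" where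
  dominant: "is_schubert w (mon (invcode w))"
    if "fin_perm w" "dominant w"
| ascent: "is_schubert w (divdiff i f)"
    if "i \<ge> 1" "w i < w (i + 1)" "is_schubert (w \<circ> transpose i (i + 1)) f"

definition schubert :: "(nat \<Rightarrow> nat) \<Rightarrow> qpoly" where
  "schubert w = (THE f. is_schubert w f)"


definition std :: "nat \<Rightarrow> nat \<Rightarrow> (nat \<Rightarrow>\<^sub>0 nat) \<Rightarrow> (nat \<Rightarrow> nat)" where
  "std m n \<alpha> = (let \<beta> = Poly_Mapping.lookup (rev_comp (m + 1) n \<alpha>) in
     THE w. fin_perm w \<and>
       (\<forall>i\<ge>n + 1. w i < w (i + 1)) \<and>
       (\<forall>i\<in>{1..n}.
          (\<beta> i \<le> m \<longrightarrow> w i = \<beta> i) \<and>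
          (\<beta> i = m + 1 \<longrightarrow> w i = m + card {j \<in> {1..i}. \<beta> j = m + 1})))"

end

theory Submission
  imports Defs
begin

text \<open>
  Reversal turns the variables \<open>x\<^sub>i, x\<^sub>i\<^sub>+\<^sub>1\<close> into the inverses of \<open>x\<^sub>p\<^sub>+\<^sub>1, x\<^sub>p\<close> with \<open>p = n - i\<close>, and
  \<open>1 / x\<^sub>p\<^sub>+\<^sub>1 - 1 / x\<^sub>p = (x\<^sub>p - x\<^sub>p\<^sub>+\<^sub>1) / (x\<^sub>p x\<^sub>p\<^sub>+\<^sub>1)\<close>; hence it conjugates \<open>pihat i\<close> into \<open>divdiff p\<close>.
  Standardization turns an ascent of \<open>\<alpha>\<close> at \<open>i\<close> into an ascent of \<open>w\<close> at \<open>p\<close>, and a partition into a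
  dominant permutation whose code is the reversed partition.  So every computation of a top
  Lascoux polynomial is carried to a computation of a Schubert polynomial.  As reversal is injective,
  top Lascoux polynomials are well defined because Schubert polynomials are.
\<close>

subsection \<open>Substitution homomorphisms\<close>

text \<open>The definite descriptions have content only once existence and uniqueness are known. For
  Schubert polynomials several rules may apply to one permutation: ascents compete, and a dominant
  permutation may have ascents itself. Transfer spares a second confluence proof, with commutation
  and braid relations for \<open>pihat\<close>. It works in one direction only: \<open>w\<close> has
  ascents without a counterpart in \<open>\<alpha>\<close>, between two zero entries or past
  \<open>n\<close>, so existence of top Lascoux polynomials needs an induction of its own. Since
  reversal gives a polynomial only while exponents stay at most \<open>m\<close>, this bound must
  accompany every computation. Standardization uses \<open>m + 1\<close> where reversal uses
  \<open>m\<close> because values of permutations start at 1 and codes at 0. Snowiness keeps the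
  values up to \<open>m\<close> distinct; repeated zeros are separated by numbering them above
  \<open>m\<close> from left to right.\<close>

lemma poly_mapping_induct_keys [consumes 1, case_names zero monomial add]:
  fixes f :: "'a \<Rightarrow>\<^sub>0 'b::comm_monoid_add"
  assumes "Poly_Mapping.keys f \<subseteq> K" and zero: "P 0"
    and monomial: "\<And>a c. a \<in> K \<Longrightarrow> P (Poly_Mapping.single a c)"
    and add: "\<And>f g. P f \<Longrightarrow> P g \<Longrightarrow> P (f + g)"
  shows "P f"
  using assms(1)
proof (induction f rule: Poly_Mapping.update_induct)
  case const
  show ?case by (rule zero)
next
  case (update f a b)
  have "Poly_Mapping.update a b f = Poly_Mapping.single a b + f"
    using update(1) by (intro poly_mapping_eqI)
      (auto simp: lookup_update lookup_add lookup_single in_keys_iff when_def)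
  moreover have "a \<in> K" "Poly_Mapping.keys f \<subseteq> K"
    using update by (auto simp: keys_update)
  ultimately show ?case using update(3) monomial add by simp
qed

lemma poly_mapping_induct [case_names monomial add]:
  fixes f :: "'a \<Rightarrow>\<^sub>0 'b::comm_monoid_add"
  assumes "\<And>a c. P (Poly_Mapping.single a c)" and "\<And>f g. P f \<Longrightarrow> P g \<Longrightarrow> P (f + g)"
  shows "P f"
  using subset_UNIV[of "Poly_Mapping.keys f"]
  by (induction rule: poly_mapping_induct_keys) (use assms(1)[of _ 0] assms in auto)

lemma const_0: "const 0 = 0" and const_1: "const 1 = 1"
  and const_add: "const (a + b) = const a + const b"
  and const_mult: "const (a * b) = const a * const b"
  by (simp_all add: const_def single_add mult_single)

lemma mon_0: "mon 0 = 1" and mon_add: "mon (a + b) = mon a * mon b"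
  by (simp_all add: mon_def mult_single)

lemma single_eq_const_mon: "Poly_Mapping.single a c = const c * mon a"
  by (simp add: const_def mon_def mult_single)

lemma mon_power: "mon (Poly_Mapping.single i k) = var i ^ k"
proof (induction k)
  case 0
  show ?case by (simp add: mon_0)
next
  case (Suc k)
  have "Poly_Mapping.single i (Suc k) = Poly_Mapping.single i 1 + Poly_Mapping.single i k"
    by (simp flip: single_add)
  then show ?case using Suc by (simp add: mon_add var_def)
qed

lemma mon_eq_prod:
  assumes "finite A" "Poly_Mapping.keys a \<subseteq> A"
  shows "mon a = (\<Prod>i\<in>A. var i ^ Poly_Mapping.lookup a i)"
proof -
  have eq: "a = (\<Sum>i\<in>A. Poly_Mapping.single i (Poly_Mapping.lookup a i))"
  proof (rule poly_mapping_eqI)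
    fix j
    have "Poly_Mapping.lookup (\<Sum>i\<in>A. Poly_Mapping.single i (Poly_Mapping.lookup a i)) j
        = (\<Sum>i\<in>A. if j = i then Poly_Mapping.lookup a i else 0)"
      by (simp add: lookup_sum lookup_single when_def eq_commute)
    also have "\<dots> = Poly_Mapping.lookup a j"
      using assms by (auto simp: sum.delta in_keys_iff)
    finally show "Poly_Mapping.lookup a j = Poly_Mapping.lookup (\<Sum>i\<in>A. Poly_Mapping.single i (Poly_Mapping.lookup a i)) j" by simp
  qed
  have "mon (\<Sum>i\<in>A. g i) = (\<Prod>i\<in>A. mon (g i))" for g
    using \<open>finite A\<close> by (induction A rule: finite_induct) (auto simp: mon_0 mon_add)
  from this[of "\<lambda>i. Poly_Mapping.single i (Poly_Mapping.lookup a i)"] show ?thesis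
    by (simp add: mon_power flip: eq)
qed

lemma to_fract_0: "to_fract 0 = 0" and to_fract_1: "to_fract 1 = 1"
  and to_fract_add: "to_fract (f + g) = to_fract f + to_fract g"
  and to_fract_diff: "to_fract (f - g) = to_fract f - to_fract g"
  and to_fract_mult: "to_fract (f * g) = to_fract f * to_fract g"
  by (simp_all add: to_fract_def Zero_fract_def One_fract_def)

lemma to_fract_power: "to_fract (f ^ k) = to_fract f ^ k"
  by (induction k) (simp_all add: to_fract_1 to_fract_mult)

lemma to_fract_prod: "to_fract (prod f A) = (\<Prod>i\<in>A. to_fract (f i))"
  by (induction A rule: infinite_finite_induct) (simp_all add: to_fract_1 to_fract_mult)

lemma to_fract_eq_0_iff: "to_fract f = 0 \<longleftrightarrow> f = 0"
  using to_fract_inject[of f 0] by (simp add: to_fract_0)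

text \<open>Two instances are needed: \<open>const\<close>, for permuting variables inside the
  polynomial ring, and its composite with \<open>to_fract\<close>, for inverting variables.\<close>

locale rat_algebra =
  fixes h :: "rat \<Rightarrow> 'r::comm_ring_1"
  assumes h_0: "h 0 = 0" and h_1: "h 1 = 1"
    and h_add: "h (a + b) = h a + h b" and h_mult: "h (a * b) = h a * h b"
begin

lemma substitute_superset:
  assumes "finite A" "Poly_Mapping.keys f \<subseteq> A"
  shows "substitute h \<phi> f = (\<Sum>a\<in>A. h (Poly_Mapping.lookup f a) * (\<Prod>i\<in>Poly_Mapping.keys a. \<phi> i ^ Poly_Mapping.lookup a i))"
  unfolding substitute_def
  using assms by (intro sum.mono_neutral_left) (auto simp: in_keys_iff h_0)

lemma substitute_0: "substitute h \<phi> 0 = 0"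
  by (simp add: substitute_def)

lemma substitute_single:
  "substitute h \<phi> (Poly_Mapping.single a c) = h c * (\<Prod>i\<in>Poly_Mapping.keys a. \<phi> i ^ Poly_Mapping.lookup a i)"
  by (subst substitute_superset[of "{a}"]) auto

lemma substitute_mon_superset:
  assumes "finite A" "Poly_Mapping.keys a \<subseteq> A"
  shows "substitute h \<phi> (mon a) = (\<Prod>i\<in>A. \<phi> i ^ Poly_Mapping.lookup a i)"
proof -
  have "substitute h \<phi> (mon a) = (\<Prod>i\<in>Poly_Mapping.keys a. \<phi> i ^ Poly_Mapping.lookup a i)"
    by (simp add: mon_def substitute_single h_1)
  also have "\<dots> = (\<Prod>i\<in>A. \<phi> i ^ Poly_Mapping.lookup a i)"
    using assms by (intro prod.mono_neutral_left) (auto simp: in_keys_iff)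
  finally show ?thesis .
qed

lemma substitute_const: "substitute h \<phi> (const c) = h c"
  by (simp add: const_def substitute_single)

lemma substitute_1: "substitute h \<phi> 1 = 1"
  using substitute_const[of \<phi> 1] by (simp add: const_1 h_1)

lemma substitute_var: "substitute h \<phi> (var i) = \<phi> i"
  by (simp add: var_def mon_def substitute_single h_1)

lemma substitute_add: "substitute h \<phi> (f + g) = substitute h \<phi> f + substitute h \<phi> g"
proof -
  let ?A = "Poly_Mapping.keys f \<union> Poly_Mapping.keys g"
  have "Poly_Mapping.keys (f + g) \<subseteq> ?A" by (rule keys_add)
  then show ?thesis
    by (simp add: substitute_superset[of ?A] lookup_add h_add distrib_right sum.distrib)
qed

lemma substitute_mon_add:
  "substitute h \<phi> (mon (a + b)) = substitute h \<phi> (mon a) * substitute h \<phi> (mon b)"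
proof -
  let ?A = "Poly_Mapping.keys a \<union> Poly_Mapping.keys b"
  have "Poly_Mapping.keys (a + b) \<subseteq> ?A" by (rule keys_add)
  then show ?thesis
    by (simp add: substitute_mon_superset[of ?A] lookup_add power_add prod.distrib)
qed

lemma substitute_single':
  "substitute h \<phi> (Poly_Mapping.single a c) = h c * substitute h \<phi> (mon a)"
  by (simp add: substitute_single mon_def h_1)

lemma substitute_mult: "substitute h \<phi> (f * g) = substitute h \<phi> f * substitute h \<phi> g"
proof (induction f rule: poly_mapping_induct)
  case (monomial a c)
  show ?case
  proof (induction g rule: poly_mapping_induct)
    case (monomial b d)
    show ?case
      by (simp add: mult_single substitute_single' substitute_mon_add h_mult mult_ac)
  next
    case (add f g)
    then show ?case by (simp add: distrib_left substitute_add)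
  qed
next
  case (add f g)
  then show ?case by (simp add: distrib_right substitute_add)
qed

lemma substitute_diff: "substitute h \<phi> (f - g) = substitute h \<phi> f - substitute h \<phi> g"
  using substitute_add[of \<phi> "f - g" g] by (simp add: algebra_simps)

end

interpretation const: rat_algebra const
  by unfold_locales (rule const_0 const_1 const_add const_mult)+

interpretation fract: rat_algebra "\<lambda>c. to_fract (const c)"
  by unfold_locales
    (simp_all add: const_0 const_1 const_add const_mult to_fract_0 to_fract_1 to_fract_add to_fract_mult)

subsection \<open>Divided differences\<close>

lemma swap_poly_add: "swap_poly i (f + g) = swap_poly i f + swap_poly i g"
  and swap_poly_diff: "swap_poly i (f - g) = swap_poly i f - swap_poly i g"
  and swap_poly_mult: "swap_poly i (f * g) = swap_poly i f * swap_poly i g"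
  and swap_poly_var: "swap_poly i (var j) = var (transpose i (i + 1) j)"
  and swap_poly_1: "swap_poly i 1 = 1"
  by (simp_all add: swap_poly_def const.substitute_add const.substitute_diff
      const.substitute_mult const.substitute_var const.substitute_1)

lemma keys_swap_comp: "Poly_Mapping.keys (swap_comp i a) = transpose i (i + 1) ` Poly_Mapping.keys a"
  by (rule set_eqI) (simp only: in_keys_iff lookup_swap_comp in_transpose_image_iff)

lemma swap_poly_mon: "swap_poly i (mon a) = mon (swap_comp i a)"
proof -
  let ?t = "transpose i (i + 1)"
  have "mon (swap_comp i a) = (\<Prod>j\<in>?t ` Poly_Mapping.keys a. var j ^ Poly_Mapping.lookup a (?t j))"
    by (subst mon_eq_prod[of "?t ` Poly_Mapping.keys a"]) (simp_all add: keys_swap_comp lookup_swap_comp)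
  also have "\<dots> = (\<Prod>j\<in>Poly_Mapping.keys a. var (?t j) ^ Poly_Mapping.lookup a j)"
    by (subst prod.reindex) (simp_all add: o_def)
  also have "\<dots> = swap_poly i (mon a)"
    unfolding swap_poly_def by (subst const.substitute_mon_superset[of "Poly_Mapping.keys a"]) simp_all
  finally show ?thesis by simp
qed

lemma swap_poly_const: "swap_poly i (const c) = const c"
  by (simp add: swap_poly_def const.substitute_const)

lemma swap_poly_single: "swap_poly i (Poly_Mapping.single a c) = Poly_Mapping.single (swap_comp i a) c"
  by (simp add: single_eq_const_mon swap_poly_mult swap_poly_const swap_poly_mon)

lemma swap_poly_involutory: "swap_poly i (swap_poly i f) = f"
proof (induction f rule: poly_mapping_induct)
  case (monomial a c)
  have "swap_comp i (swap_comp i a) = a"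
    by (intro poly_mapping_eqI) (simp add: lookup_swap_comp)
  then show ?case by (simp add: swap_poly_single)
qed (simp add: swap_poly_add)

lemma swap_poly_commute:
  assumes "i + 1 < j"
  shows "swap_poly i (swap_poly j f) = swap_poly j (swap_poly i f)"
proof (induction f rule: poly_mapping_induct)
  case (monomial a c)
  have "swap_comp i (swap_comp j a) = swap_comp j (swap_comp i a)"
    using assms by (intro poly_mapping_eqI) (auto simp: lookup_swap_comp transpose_def)
  then show ?case by (simp add: swap_poly_single)
qed (simp add: swap_poly_add)

lemma swap_poly_braid:
  "swap_poly i (swap_poly (i + 1) (swap_poly i f)) = swap_poly (i + 1) (swap_poly i (swap_poly (i + 1) f))"
proof (induction f rule: poly_mapping_induct)
  case (monomial a c)
  have "swap_comp i (swap_comp (i + 1) (swap_comp i a)) = swap_comp (i + 1) (swap_comp i (swap_comp (i + 1) a))"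
    by (intro poly_mapping_eqI) (simp add: lookup_swap_comp transpose_def)
  then show ?case by (simp add: swap_poly_single)
qed (simp add: swap_poly_add)


section \<open>Divisibility and the relations between divided differences\<close>

lemma var_neq: "i \<noteq> j \<Longrightarrow> var i - var j \<noteq> 0"
  unfolding var_def mon_def
  by (metis diff_eq_diff_eq diff_self lookup_single_eq lookup_single_not_eq one_neq_zero)

text \<open>The exponent bounds are what makes \<open>pihat\<close> preserve the domain of \<open>rev_poly\<close>.\<close>

lemma divdiff_mon_exists:
  "\<exists>g. (var i - var (i + 1)) * g = mon a - swap_poly i (mon a) \<and>
     (\<forall>b\<in>Poly_Mapping.keys (var i * var (i + 1) * g).
        (\<forall>j. j \<noteq> i \<longrightarrow> j \<noteq> i + 1 \<longrightarrow> Poly_Mapping.lookup b j = Poly_Mapping.lookup a j) \<and>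
        Poly_Mapping.lookup b i \<le> max (Poly_Mapping.lookup a i) (Poly_Mapping.lookup a (i + 1)) \<and>
        Poly_Mapping.lookup b (i + 1) \<le> max (Poly_Mapping.lookup a i) (Poly_Mapping.lookup a (i + 1)))"
    (is "\<exists>g. ?P g \<and> (\<forall>b\<in>Poly_Mapping.keys (?x * ?y * g). ?Q b)")
proof -
  \<comment> \<open>\<open>mon c\<close> is the part of the monomial symmetric in the two variables.
    It factors out and leaves a pure power \<open>d\<close> of one variable, so up to sign
    \<open>g\<close> is \<open>mon c\<close> times the geometric sum for
    \<open>x^d - y^d\<close>.\<close>
  define e where "e = min (Poly_Mapping.lookup a i) (Poly_Mapping.lookup a (i + 1))"
  define d where "d = max (Poly_Mapping.lookup a i) (Poly_Mapping.lookup a (i + 1)) - e"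
  define c where "c = Poly_Mapping.update i e (Poly_Mapping.update (i + 1) e a)"
  define g where "g = mon c * (\<Sum>k<d. ?x ^ k * ?y ^ (d - Suc k))"
  have lc: "Poly_Mapping.lookup c j = (if j = i \<or> j = i + 1 then e else Poly_Mapping.lookup a j)" for j
    by (simp add: c_def lookup_update)
  have sc: "swap_comp i c = c"
    by (intro poly_mapping_eqI) (auto simp: lookup_swap_comp lc transpose_def)
  have "(\<Sum>k<d. ?x ^ k * ?y ^ (d - Suc k)) * (?x - ?y) = ?x ^ d - ?y ^ d"
  proof (cases d)
    case (Suc l)
    then show ?thesis
      using diff_power_eq_sum[of ?x l ?y] by (simp add: mult.commute)
  qed simp
  then have g: "(?x - ?y) * g = mon c * (?x ^ d - ?y ^ d)"
    by (simp add: g_def mult_ac)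
  have xyg: "?x * ?y * g = (\<Sum>k<d. mon (c + Poly_Mapping.single i (Suc k) + Poly_Mapping.single (i + 1) (d - k)))"
    unfolding g_def sum_distrib_left
  proof (rule sum.cong)
    fix k assume "k \<in> {..<d}"
    then have "d - k = Suc (d - Suc k)" by auto
    then show "?x * ?y * (mon c * (?x ^ k * ?y ^ (d - Suc k))) = mon (c + Poly_Mapping.single i (Suc k) + Poly_Mapping.single (i + 1) (d - k))"
      by (simp add: mon_add mon_power mult_ac)
  qed simp
  \<comment> \<open>The two exponents are \<open>e + k + 1\<close> and \<open>e + d - k\<close> with
    \<open>k < d\<close>, hence at most \<open>e + d\<close>, which is the larger exponent of
    \<open>a\<close>.\<close>
  have Q: "?Q b" if "b \<in> Poly_Mapping.keys (?x * ?y * g)" for b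
  proof -
    from that obtain k where k: "k < d" "b = c + Poly_Mapping.single i (Suc k) + Poly_Mapping.single (i + 1) (d - k)"
      unfolding xyg using keys_sum[of "\<lambda>k. mon (c + Poly_Mapping.single i (Suc k) + Poly_Mapping.single (i + 1) (d - k))" "{..<d}"]
      by (auto simp: mon_def)
    show ?thesis
      using k(1) by (auto simp: k(2) lookup_add lookup_single lc d_def e_def when_def)
  qed
  show ?thesis
  proof (cases "Poly_Mapping.lookup a (i + 1) \<le> Poly_Mapping.lookup a i")
    case True
    have "a = c + Poly_Mapping.single i d"
      using True by (intro poly_mapping_eqI) (auto simp: lookup_add lookup_single lc d_def e_def when_def)
    then have "mon a = mon c * ?x ^ d" by (simp add: mon_add mon_power)
    moreover have "swap_poly i (mon c * ?x ^ d) = mon c * ?y ^ d"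
      by (induction d) (simp_all add: swap_poly_mult swap_poly_mon sc swap_poly_1 swap_poly_var mult.assoc
          mult.left_commute[of "mon c" ?x] mult.left_commute[of "mon c" ?y])
    ultimately have "?P g" unfolding g by (simp add: right_diff_distrib)
    with Q show ?thesis by blast
  next
    case False
    have "a = c + Poly_Mapping.single (i + 1) d"
      using False by (intro poly_mapping_eqI) (auto simp: lookup_add lookup_single lc d_def e_def when_def)
    then have "mon a = mon c * ?y ^ d" by (simp add: mon_add mon_power)
    moreover have "swap_poly i (mon c * ?y ^ d) = mon c * ?x ^ d"
      by (induction d) (simp_all add: swap_poly_mult swap_poly_mon sc swap_poly_1 swap_poly_var mult.assoc
          mult.left_commute[of "mon c" ?x] mult.left_commute[of "mon c" ?y])
    moreover have "(?x - ?y) * (- g) = mon c * ?y ^ d - mon c * ?x ^ d"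
      unfolding mult_minus_right g by (simp add: algebra_simps)
    ultimately have "?P (- g)" by simp
    moreover have "Poly_Mapping.keys (?x * ?y * (- g)) = Poly_Mapping.keys (?x * ?y * g)"
      by (auto simp: in_keys_iff)
    ultimately show ?thesis using Q by (metis (no_types, lifting))
  qed
qed

text \<open>Divisibility is a linear condition, so it is inherited from monomials; the quotient is
  then the one described by \<open>divdiff\<close>.\<close>

lemma divdiff_mult: "(var i - var (i + 1)) * divdiff i f = f - swap_poly i f"
proof -
  have "\<exists>g. (var i - var (i + 1)) * g = f - swap_poly i f"
  proof (induction f rule: poly_mapping_induct)
    case (monomial a c)
    obtain g where "(var i - var (i + 1)) * g = mon a - swap_poly i (mon a)"
      using divdiff_mon_exists by blast
    then have "(var i - var (i + 1)) * (const c * g) = Poly_Mapping.single a c - swap_poly i (Poly_Mapping.single a c)"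
      by (simp add: single_eq_const_mon swap_poly_mult swap_poly_const mult.left_commute right_diff_distrib')
    then show ?case by blast
  next
    case (add f g)
    then obtain f' g' where "(var i - var (i + 1)) * f' = f - swap_poly i f"
      "(var i - var (i + 1)) * g' = g - swap_poly i g" by blast
    then have "(var i - var (i + 1)) * (f' + g') = f + g - swap_poly i (f + g)"
      by (simp add: distrib_left swap_poly_add)
    then show ?case by blast
  qed
  then show ?thesis using divdiff_eqI by metis
qed

lemma divdiff_add: "divdiff i (f + g) = divdiff i f + divdiff i g"
  by (rule divdiff_eqI) (simp add: distrib_left divdiff_mult[simplified] swap_poly_add)

lemma divdiff_const_mult: "divdiff i (const c * f) = const c * divdiff i f"
  by (rule divdiff_eqI)
    (simp add: swap_poly_mult swap_poly_const divdiff_mult[simplified] mult.left_commute[of _ "const c"] right_diff_distrib')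

text \<open>The ring homomorphism \<open>swap_poly j\<close> is applied to the defining equation.
  Such equations turn the relations below into polynomial identities without denominators.\<close>

lemma swap_divdiff_mult:
  "(var (transpose j (j + 1) i) - var (transpose j (j + 1) (i + 1))) * swap_poly j (divdiff i f)
     = swap_poly j f - swap_poly j (swap_poly i f)"
  using arg_cong[OF divdiff_mult[of i f], of "swap_poly j"]
  by (simp add: swap_poly_mult swap_poly_diff swap_poly_var)

lemma divdiff_commute:
  assumes "i + 1 < j"
  shows "divdiff i (divdiff j f) = divdiff j (divdiff i f)"
proof -
  let ?a = "var i - var (i + 1)" and ?b = "var j - var (j + 1)"
  have eqs: "?a * divdiff i (divdiff j f) = divdiff j f - swap_poly i (divdiff j f)"
    "?b * divdiff j f = f - swap_poly j f"
    "?b * swap_poly i (divdiff j f) = swap_poly i f - swap_poly i (swap_poly j f)"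
    "?b * divdiff j (divdiff i f) = divdiff i f - swap_poly j (divdiff i f)"
    "?a * divdiff i f = f - swap_poly i f"
    "?a * swap_poly j (divdiff i f) = swap_poly j f - swap_poly i (swap_poly j f)"
    using divdiff_mult[of i] divdiff_mult[of j] swap_divdiff_mult[of i j f] swap_divdiff_mult[of j i f]
      assms swap_poly_commute[OF assms]
    by simp_all
  \<comment> \<open>Both sides are the alternating sum of \<open>f\<close> over the four products of
    the two commuting swaps.\<close>
  have "?a * ?b * divdiff i (divdiff j f) = ?a * ?b * divdiff j (divdiff i f)"
    using eqs by algebra
  then show ?thesis
    using var_neq[of i "i + 1"] var_neq[of j "j + 1"] by simp
qed

text \<open>Both sides, multiplied by the Vandermonde product, equal the alternating sum of \<open>f\<close> over the
  symmetric group generated by the two transpositions.\<close>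

lemma divdiff_braid:
  "divdiff i (divdiff (i + 1) (divdiff i f)) = divdiff (i + 1) (divdiff i (divdiff (i + 1) f))"
proof -
  let ?s = "swap_poly i" and ?t = "swap_poly (i + 1)"
  let ?a = "var i" and ?b = "var (i + 1)" and ?c = "var (i + 2)"
  let ?A = "f - ?s f - ?t f + ?s (?t f) + ?t (?s f) - ?s (?t (?s f))"
  let ?D = "(?a - ?b) * (?a - ?c) * (?b - ?c)"
  have nz: "?a - ?b \<noteq> 0" "?a - ?c \<noteq> 0" "?b - ?c \<noteq> 0"
    by (rule var_neq; simp)+
  have S: "(?a - ?b) * divdiff i g = g - ?s g" "(?a - ?c) * ?t (divdiff i g) = ?t g - ?t (?s g)"
    "(?b - ?a) * ?s (divdiff i g) = ?s g - g" for g
    using divdiff_mult[of i g] swap_divdiff_mult[of "i + 1" i g] swap_divdiff_mult[of i i g]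
    by (simp_all add: transpose_def swap_poly_involutory numeral_2_eq_2)
  have T: "(?b - ?c) * divdiff (i + 1) g = g - ?t g" "(?a - ?c) * ?s (divdiff (i + 1) g) = ?s g - ?s (?t g)"
    "(?c - ?b) * ?t (divdiff (i + 1) g) = ?t g - g" for g
    using divdiff_mult[of "i + 1" g] swap_divdiff_mult[of i "i + 1" g] swap_divdiff_mult[of "i + 1" "i + 1" g]
    by (simp_all add: transpose_def swap_poly_involutory numeral_2_eq_2)
  have st: "(?b - ?c) * ?s (?t (divdiff i f)) = ?s (?t f) - ?s (?t (?s f))"
    using arg_cong[OF S(2)[of f], of ?s]
    by (simp add: swap_poly_mult swap_poly_diff swap_poly_var transpose_def)
  have ts: "(?a - ?b) * ?t (?s (divdiff (i + 1) f)) = ?t (?s f) - ?s (?t (?s f))"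
    using arg_cong[OF T(2)[of f], of ?t]
    by (simp add: swap_poly_mult swap_poly_diff swap_poly_var transpose_def swap_poly_braid[of i, simplified])
  \<comment> \<open>The extra factor \<open>?a - ?b\<close> is there because the symmetry of
    \<open>divdiff i f\<close> under \<open>?s\<close> is available from \<open>S\<close> only after
    multiplication by it; \<open>?b - ?c\<close> plays the same role on the other side.\<close>
  have "(?a - ?b) * (?D * divdiff i (divdiff (i + 1) (divdiff i f))) = (?a - ?b) * ?A"
    using S(1)[of f] S(2)[of f] S(3)[of f] st T(1)[of "divdiff i f"] T(2)[of "divdiff i f"]
      S(1)[of "divdiff (i + 1) (divdiff i f)"]
    by algebra
  moreover have "(?b - ?c) * (?D * divdiff (i + 1) (divdiff i (divdiff (i + 1) f))) = (?b - ?c) * ?A"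
    using T(1)[of f] T(2)[of f] T(3)[of f] ts S(1)[of "divdiff (i + 1) f"] S(2)[of "divdiff (i + 1) f"]
      T(1)[of "divdiff i (divdiff (i + 1) f)"]
    by algebra
  ultimately show ?thesis using nz by (metis mult_cancel_left mult_eq_0_iff)
qed

subsection \<open>Uniqueness of Schubert polynomials\<close>

definition inversions_below :: "(nat \<Rightarrow> nat) \<Rightarrow> nat \<Rightarrow> nat set" where
  "inversions_below w i = {j. i < j \<and> w j < w i}"

lemma finite_inversions_below:
  assumes "w permutes {1..N}"
  shows "finite (inversions_below w i)"
proof -
  have "inversions_below w i \<subseteq> w -` {..<w i}" by (auto simp: inversions_below_def)
  moreover have "finite (w -` {..<w i})"
    using permutes_inj[OF assms] by (intro finite_vimageI) auto
  ultimately show ?thesis by (rule finite_subset)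
qed

lemma fin_perm_iff: "fin_perm w \<longleftrightarrow> (\<exists>N. w permutes {1..N})"
proof
  assume w: "fin_perm w"
  then obtain N where N: "\<And>i. w i \<noteq> i \<Longrightarrow> i \<le> N"
    unfolding fin_perm_def finite_nat_set_iff_bounded_le by auto
  have "w permutes {1..N}"
    by (rule permutes_superset[of w "{1..}"]) (use w N in \<open>force simp: fin_perm_def\<close>)+
  then show "\<exists>N. w permutes {1..N}" by blast
next
  assume "\<exists>N. w permutes {1..N}"
  then obtain N where N: "w permutes {1..N}" by blast
  have "{i. w i \<noteq> i} \<subseteq> {1..N}"
    using N by (auto simp: permutes_def)
  then show "fin_perm w"
    using permutes_subset[OF N, of "{1..}"] by (auto simp: fin_perm_def intro: finite_subset)
qed

lemma lookup_invcode_permutes: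
  assumes "w permutes {1..N}"
  shows "Poly_Mapping.lookup (invcode w) i = card (inversions_below w i)"
  using assms by (subst lookup_invcode) (auto simp: fin_perm_iff inversions_below_def)

text \<open>Position \<open>i + 1\<close> is no inversion of \<open>i\<close>, and later values
  below \<open>w i\<close> are also below \<open>w (i + 1)\<close>. For dominant \<open>w\<close>
  this forces equality of the two entries.\<close>

lemma invcode_ascent_le:
  assumes "w permutes {1..N}" "w i < w (i + 1)"
  shows "Poly_Mapping.lookup (invcode w) i \<le> Poly_Mapping.lookup (invcode w) (i + 1)"
proof -
  have "inversions_below w i \<subseteq> inversions_below w (i + 1)"
    using assms(2) by (auto simp: inversions_below_def) (metis Suc_lessI less_asym)
  then show ?thesis
    using assms by (simp add: lookup_invcode_permutes card_mono finite_inversions_below)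
qed

lemma invcode_descent_less:
  assumes "w permutes {1..N}" "w (i + 1) < w i"
  shows "Poly_Mapping.lookup (invcode w) (i + 1) < Poly_Mapping.lookup (invcode w) i"
proof -
  have "inversions_below w (i + 1) \<subset> inversions_below w i"
    using assms(2) by (auto simp: inversions_below_def)
  then show ?thesis
    using assms by (simp add: lookup_invcode_permutes psubset_card_mono finite_inversions_below)
qed

lemma permutes_comp_transpose:
  fixes i N :: nat
  assumes "w permutes {1..N}" "1 \<le> i" "i < N"
  shows "w \<circ> transpose i (i + 1) permutes {1..N}"
proof -
  have "i \<in> {1..N}" "i + 1 \<in> {1..N}" using assms by auto
  then show ?thesis using assms(1) by (intro permutes_compose permutes_swap_id)
qed

text \<open>At an ascent the transposition exchanges code entries \<open>i\<close> and
  \<open>i + 1\<close> and then adds 1 at \<open>i\<close>. Equal entries hide the exchange, so only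
  one extra factor of the monomial remains.\<close>

lemma invcode_comp_transpose:
  assumes w: "w permutes {1..N}" and i: "1 \<le> i" "i < N" and asc: "w i < w (i + 1)"
    and eq: "Poly_Mapping.lookup (invcode w) i = Poly_Mapping.lookup (invcode w) (i + 1)"
  shows "invcode (w \<circ> transpose i (i + 1)) = invcode w + Poly_Mapping.single i 1"
proof (rule poly_mapping_eqI)
  fix k
  let ?t = "transpose i (i + 1)"
  let ?v = "w \<circ> ?t"
  note v = permutes_comp_transpose[OF w i]
  consider "k = i" | "k = i + 1" | "k \<noteq> i" "k \<noteq> i + 1" by blast
  then show "Poly_Mapping.lookup (invcode ?v) k = Poly_Mapping.lookup (invcode w + Poly_Mapping.single i 1) k"
  proof cases
    case 1
    have "inversions_below ?v i = insert (i + 1) (inversions_below w (i + 1))"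
      using asc by (auto simp: inversions_below_def transpose_def)
    moreover have "i + 1 \<notin> inversions_below w (i + 1)"
      by (simp add: inversions_below_def)
    ultimately show ?thesis
      using w v 1 eq by (simp add: lookup_invcode_permutes finite_inversions_below lookup_add)
  next
    case 2
    have "inversions_below ?v (i + 1) = inversions_below w i"
      using asc by (auto simp: inversions_below_def transpose_def)
    then show ?thesis
      using w v 2 eq by (simp add: lookup_invcode_permutes lookup_add lookup_single)
  next
    case 3
    have "inversions_below ?v k = ?t ` inversions_below w k"
      using 3 by (auto simp: inversions_below_def in_transpose_image_iff transpose_def split: if_splits)
    then show ?thesis
      using w v 3 by (simp add: lookup_invcode_permutes lookup_add lookup_single card_image)
  qed
qed

text \<open>This is the longest element of the finite symmetric group, where climbing through
  ascents must stop.\<close>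

lemma dominant_if_decreasing:
  assumes w: "w permutes {1..N}" and desc: "\<And>i. 1 \<le> i \<Longrightarrow> i < N \<Longrightarrow> w (i + 1) < w i"
  shows "dominant w"
  unfolding dominant_def is_partition_def
proof (intro allI impI)
  fix i :: nat assume "1 \<le> i"
  show "Poly_Mapping.lookup (invcode w) (i + 1) \<le> Poly_Mapping.lookup (invcode w) i"
  proof (cases "i < N")
    case True
    then show ?thesis using invcode_descent_less[OF w desc] \<open>1 \<le> i\<close> by (simp add: less_imp_le)
  next
    case False
    then have "w j = j" if "i < j" for j
      using w that by (auto simp: permutes_def)
    then have "inversions_below w (i + 1) = {}"
      by (auto simp: inversions_below_def)
    then show ?thesis using w by (simp add: lookup_invcode_permutes)
  qed
qed

text \<open>A factor symmetric in the two variables passes through \<open>divdiff i\<close>, and the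
  divided difference of \<open>var i\<close> is 1.\<close>

lemma divdiff_mon_var:
  assumes "swap_comp i c = c"
  shows "divdiff i (mon (c + Poly_Mapping.single i 1)) = mon c"
  by (rule divdiff_eqI)
    (simp add: mon_add swap_poly_mult swap_poly_mon assms mon_power[of i "Suc 0", simplified] swap_poly_var algebra_simps)

text \<open>Computations confined to one finite symmetric group. Without a bound, even the identity
  has ascents at every position, so climbing need not terminate.\<close>

inductive schubert_within :: "nat \<Rightarrow> (nat \<Rightarrow> nat) \<Rightarrow> qpoly \<Rightarrow> bool" for N where
  dominant: "schubert_within N w (mon (invcode w))"
    if "w permutes {1..N}" "dominant w"
| ascent: "schubert_within N w (divdiff i f)"
    if "w permutes {1..N}" "1 \<le> i" "i < N" "w i < w (i + 1)"
      "schubert_within N (w \<circ> transpose i (i + 1)) f"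

lemma schubert_within_permutes: "schubert_within N w f \<Longrightarrow> w permutes {1..N}"
  by (erule schubert_within.cases) auto

lemma schubert_within_mono:
  assumes "schubert_within N w f" "N \<le> M"
  shows "schubert_within M w f"
  using assms(1)
proof induction
  case (dominant w)
  have "w permutes {1..M}"
    using assms(2) by (intro permutes_subset[OF dominant(1)]) auto
  then show ?case using dominant assms(2) by (intro schubert_within.dominant) auto
next
  case (ascent w i f)
  have "w permutes {1..M}"
    using assms(2) by (intro permutes_subset[OF ascent(1)]) auto
  then show ?case using ascent assms(2) by (intro schubert_within.ascent) (simp_all add: comp_def)
qed

lemma is_schubert_within:
  assumes "is_schubert w f"
  shows "\<exists>N. schubert_within N w f"
  using assms
proof induction
  case (dominant w)
  then show ?case using schubert_within.dominant fin_perm_iff by blast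
next
  case (ascent i w f)
  let ?t = "transpose i (i + 1)"
  from ascent obtain N where "schubert_within N (w \<circ> ?t) f" by blast
  \<comment> \<open>The enlarged bound makes room for both positions \<open>i\<close> and
    \<open>i + 1\<close>.\<close>
  then have N: "schubert_within (N + i + 1) (w \<circ> ?t) f"
    by (rule schubert_within_mono) simp
  then have "(w \<circ> ?t) \<circ> ?t permutes {1..N + i + 1}"
    using ascent(1) by (intro permutes_comp_transpose schubert_within_permutes) auto
  then have "w permutes {1..N + i + 1}" by (simp add: comp_assoc)
  with N ascent(1,2) have "schubert_within (N + i + 1) w (divdiff i f)"
    by (intro schubert_within.ascent) auto
  then show ?case by blast
qed

text \<open>The sum drops by exactly \<open>w (i + 1) - w i\<close>. As \<open>w\<close> is any
  function, the same measure later serves weak compositions.\<close>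

lemma weighted_sum_comp_transpose_less:
  assumes "1 \<le> i" "i < N" "w i < w (i + 1)"
  shows "(\<Sum>k\<in>{1..N}. k * (w \<circ> transpose i (i + 1)) k) < (\<Sum>k\<in>{1..N}. k * (w k :: nat))"
proof -
  let ?t = "transpose i (i + 1)" and ?R = "{1..N} - {i} - {i + 1}"
  have split: "(\<Sum>k\<in>{1..N}. g k) = g i + (g (i + 1) + sum g ?R)" for g :: "nat \<Rightarrow> nat"
    using assms by (subst sum.remove[of _ i], simp, simp, subst sum.remove[of _ "i + 1"]) auto
  have rest: "(\<Sum>k\<in>?R. k * (w \<circ> ?t) k) = (\<Sum>k\<in>?R. k * w k)"
    by (intro sum.cong) auto
  obtain d where "w (i + 1) = w i + Suc d"
    using assms(3) less_imp_Suc_add by auto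
  then have "i * w (i + 1) + (i + 1) * w i < i * w i + (i + 1) * w (i + 1)"
    by (simp add: algebra_simps)
  then show ?thesis
    by (simp only: split rest) simp
qed

text \<open>Confluence by going up in length inside a finite symmetric group, which terminates because it
  decreases the sum of the \<open>k * w k\<close>.  Two ascents are joined by a commutation or braid relation.  At an ascent \<open>i\<close> of a
  dominant permutation, either \<open>i - 1\<close> is an ascent too, or the swapped permutation is again
  dominant and its monomial has exactly one additional factor \<open>x\<^sub>i\<close>.\<close>

lemma schubert_within_unique:
  assumes "w permutes {1..N}"
  shows "\<exists>!f. schubert_within N w f"
  using assms
proof (induction "\<Sum>k\<in>{1..N}. k * w k" arbitrary: w rule: less_induct)
  case less
  note w = less.prems
  define s where "s i = transpose i (i + 1)" for i :: nat
  define asc where "asc v i \<longleftrightarrow> 1 \<le> i \<and> i < N \<and> v i < v (i + 1)" for v :: "nat \<Rightarrow> nat" and i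
  define \<mu> where "\<mu> v = (\<Sum>k\<in>{1..N}. k * v k)" for v :: "nat \<Rightarrow> nat"
  \<comment> \<open>By the induction hypothesis \<open>S v\<close> is the unique result whenever
    \<open>\<mu> v < \<mu> w\<close>.\<close>
  define S where "S v = (THE f. schubert_within N v f)" for v
  have up: "v \<circ> s i permutes {1..N} \<and> \<mu> (v \<circ> s i) < \<mu> v" if "v permutes {1..N}" "asc v i" for v i
    using permutes_comp_transpose[of v N i] weighted_sum_comp_transpose_less[of i N v] that
    by (simp add: asc_def s_def \<mu>_def)
  have S_iff: "schubert_within N v f \<longleftrightarrow> f = S v" if "v permutes {1..N}" "\<mu> v < \<mu> w" for v f
    using less.hyps[of v] that unfolding S_def \<mu>_def by (metis theI')
  have S_asc: "S v = divdiff i (S (v \<circ> s i))" if "v permutes {1..N}" "\<mu> v < \<mu> w" "asc v i" for v i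
  proof -
    have "schubert_within N (v \<circ> s i) (S (v \<circ> s i))"
      using up[OF that(1,3)] that(2) by (subst S_iff) auto
    then have "schubert_within N v (divdiff i (S (v \<circ> s i)))"
      using that unfolding asc_def s_def by (intro schubert_within.ascent) auto
    then show ?thesis using S_iff that by simp
  qed
  define T where "T i = divdiff i (S (w \<circ> s i))" for i
  \<comment> \<open>Uniqueness for \<open>w\<close> now means that all \<open>T i\<close> at ascents
    agree with each other and, if \<open>w\<close> is dominant, with its monomial.\<close>
  have within_iff: "schubert_within N w f \<longleftrightarrow> dominant w \<and> f = mon (invcode w) \<or> (\<exists>i. asc w i \<and> f = T i)" for f
  proof
    assume "schubert_within N w f"
    then show "dominant w \<and> f = mon (invcode w) \<or> (\<exists>i. asc w i \<and> f = T i)"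
    proof cases
      case (ascent i g)
      then have i: "asc w i" by (simp add: asc_def)
      then have "g = S (w \<circ> s i)" using ascent up[OF w i] S_iff by (simp add: s_def)
      with i ascent show ?thesis by (auto simp: T_def)
    qed simp
  next
    assume "dominant w \<and> f = mon (invcode w) \<or> (\<exists>i. asc w i \<and> f = T i)"
    then show "schubert_within N w f"
    proof (elim disjE exE conjE)
      fix i assume i: "asc w i" "f = T i"
      have "schubert_within N (w \<circ> s i) (S (w \<circ> s i))"
        using up[OF w i(1)] by (subst S_iff) auto
      then show ?thesis
        using i w unfolding T_def asc_def s_def by (auto intro!: schubert_within.ascent)
    qed (use w schubert_within.dominant in auto)
  qed
  \<comment> \<open>The prefix \<open>p\<close> is the word of swaps performed so far, so that steps
    can be chained along a commutation or braid relation.\<close>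
  have step: "S (w \<circ> p) = divdiff j (S (w \<circ> p \<circ> s j)) \<and> w \<circ> p \<circ> s j permutes {1..N} \<and> \<mu> (w \<circ> p \<circ> s j) < \<mu> w"
    if "w \<circ> p permutes {1..N}" "\<mu> (w \<circ> p) < \<mu> w" "asc (w \<circ> p) j" for p j
    using S_asc[OF that] up[OF that(1,3)] that(2) by auto
  have T_less: "T i = T j" if asc: "asc w i" "asc w j" and "i < j" for i j
  proof -
    have i: "w \<circ> s i permutes {1..N}" "\<mu> (w \<circ> s i) < \<mu> w"
      and j: "w \<circ> s j permutes {1..N}" "\<mu> (w \<circ> s j) < \<mu> w"
      using up[OF w] asc by auto
    show ?thesis
    proof (cases "j = i + 1")
      case True
      \<comment> \<open>Three consecutive increasing values: both braid words climb through ascents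
        only, up to the same permutation.\<close>
      have lt: "w i < w (i + 1)" "w (i + 1) < w (i + 2)" "1 \<le> i" "i + 1 < N"
        using asc True by (auto simp: asc_def)
      have 1: "asc (w \<circ> s i) j" "asc (w \<circ> s j) i"
        using lt by (auto simp: asc_def s_def True transpose_def)
      note i1 = step[OF i 1(1)] and j1 = step[OF j 1(2)]
      have 2: "asc (w \<circ> (s i \<circ> s j)) i" "asc (w \<circ> (s j \<circ> s i)) j"
        using lt by (auto simp: asc_def s_def True transpose_def)
      note i2 = step[OF _ _ 2(1)] and j2 = step[OF _ _ 2(2)]
      have braid: "s i \<circ> s (i + 1) \<circ> s i = s (i + 1) \<circ> s i \<circ> s (i + 1)"
        by (auto simp: s_def fun_eq_iff transpose_def)
      have "T i = divdiff i (divdiff j (divdiff i (S (w \<circ> (s i \<circ> s j \<circ> s i)))))"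
        using i1 i2 by (simp add: T_def comp_assoc)
      also have "\<dots> = divdiff j (divdiff i (divdiff j (S (w \<circ> (s j \<circ> s i \<circ> s j)))))"
        unfolding True braid by (rule divdiff_braid)
      also have "\<dots> = T j"
        using j1 j2 by (simp add: T_def comp_assoc)
      finally show ?thesis .
    next
      case False
      then have ij: "i + 1 < j" using \<open>i < j\<close> by simp
      have 1: "asc (w \<circ> s i) j" "asc (w \<circ> s j) i"
        using asc ij by (auto simp: asc_def s_def transpose_def)
      have comm: "s i \<circ> s j = s j \<circ> s i"
        using ij by (auto simp: s_def fun_eq_iff transpose_def)
      have "T i = divdiff i (divdiff j (S (w \<circ> (s i \<circ> s j))))"
        using step[OF i 1(1)] by (simp add: T_def comp_assoc)
      also have "\<dots> = divdiff j (divdiff i (S (w \<circ> (s j \<circ> s i))))"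
        unfolding comm by (rule divdiff_commute[OF ij])
      also have "\<dots> = T j"
        using step[OF j 1(2)] by (simp add: T_def comp_assoc)
      finally show ?thesis .
    qed
  qed
  have T_eq: "T i = T j" if "asc w i" "asc w j" for i j
    using T_less that by (metis linorder_neqE_nat)
  have T_dominant: "T i = mon (invcode w)" if "dominant w" "asc w i" for i
    using \<open>asc w i\<close>
  proof (induction i rule: less_induct)
    case (less i)
    have i: "1 \<le> i" "i < N" "w i < w (i + 1)" using less.prems by (auto simp: asc_def)
    have part: "Poly_Mapping.lookup (invcode w) (k + 1) \<le> Poly_Mapping.lookup (invcode w) k" if "1 \<le> k" for k
      using \<open>dominant w\<close> that by (simp add: dominant_def is_partition_def)
    have eq: "Poly_Mapping.lookup (invcode w) i = Poly_Mapping.lookup (invcode w) (i + 1)"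
      using invcode_ascent_le[OF w i(3)] part[OF i(1)] by simp
    show ?case
    proof (cases "1 < i \<and> w (i - 1) < w i")
      case True
      \<comment> \<open>Adding 1 to entry \<open>i\<close> would destroy the partition here, so the
        claim is passed to the ascent on the left.\<close>
      then have "asc w (i - 1)" using i by (auto simp: asc_def)
      then have "T (i - 1) = mon (invcode w)" using less.IH[of "i - 1"] True by simp
      then show ?thesis using T_eq[OF \<open>asc w (i - 1)\<close> less.prems] by simp
    next
      case False
      have code: "invcode (w \<circ> s i) = invcode w + Poly_Mapping.single i 1"
        unfolding s_def by (rule invcode_comp_transpose[OF w i eq])
      have "dominant (w \<circ> s i)"
        unfolding dominant_def is_partition_def
      proof (intro allI impI)
        fix k :: nat assume k: "1 \<le> k"
        show "Poly_Mapping.lookup (invcode (w \<circ> s i)) (k + 1) \<le> Poly_Mapping.lookup (invcode (w \<circ> s i)) k"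
        \<comment> \<open>Raising entry \<open>i\<close> can only violate the inequality with entry
          \<open>i - 1\<close>; a descent at \<open>i - 1\<close> makes that inequality strict
          beforehand.\<close>
        proof (cases "k + 1 = i")
          case True
          then have "w (k + 1) \<noteq> w k" using inj_eq[OF permutes_inj[OF w], of "k + 1" k] by simp
          then have "w (k + 1) < w k" using False True k by auto
          from invcode_descent_less[OF w this] show ?thesis
            using True by (simp add: code lookup_add lookup_single)
        next
          case False
          then show ?thesis using part[OF k] by (auto simp: code lookup_add lookup_single when_def)
        qed
      qed
      then have "schubert_within N (w \<circ> s i) (mon (invcode (w \<circ> s i)))"
        using up[OF w less.prems] by (intro schubert_within.dominant) auto
      then have "S (w \<circ> s i) = mon (invcode w + Poly_Mapping.single i 1)"
        using S_iff up[OF w less.prems] by (simp add: code)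
      moreover have "swap_comp i (invcode w) = invcode w"
        using eq by (intro poly_mapping_eqI) (auto simp: lookup_swap_comp transpose_def)
      ultimately show ?thesis using divdiff_mon_var[of i "invcode w"] by (simp add: T_def)
    qed
  qed
  show ?case
  proof (cases "\<exists>i. asc w i")
    case True
    then obtain i where i: "asc w i" by blast
    show ?thesis
    proof (rule ex1I[of _ "T i"])
      show "schubert_within N w (T i)" using within_iff i by blast
      show "f = T i" if "schubert_within N w f" for f
        using that T_dominant[OF _ i] T_eq[OF i] by (auto simp: within_iff)
    qed
  next
    case False
    have "w (i + 1) < w i" if "1 \<le> i" "i < N" for i
    proof -
      have "w (i + 1) \<noteq> w i" using inj_eq[OF permutes_inj[OF w], of "i + 1" i] by simp
      then show ?thesis using False that by (auto simp: asc_def)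
    qed
    then have "dominant w" using dominant_if_decreasing[OF w] by blast
    then show ?thesis using within_iff False by (intro ex1I[of _ "mon (invcode w)"]) auto
  qed
qed

lemma is_schubert_unique:
  assumes "is_schubert w f" "is_schubert w g"
  shows "f = g"
proof -
  obtain N M where "schubert_within N w f" "schubert_within M w g"
    using assms is_schubert_within by meson
  then have "schubert_within (max N M) w f" "schubert_within (max N M) w g"
    by (auto elim: schubert_within_mono)
  then show ?thesis
    using schubert_within_unique schubert_within_permutes by blast
qed

lemma schubert_eqI: "is_schubert w f \<Longrightarrow> schubert w = f"
  unfolding schubert_def using is_schubert_unique by blast

subsection \<open>Reversal\<close>

text \<open>On these exponent vectors the truncated subtraction and the cut-off in
  \<open>rev_comp\<close> lose no information.\<close>

definition box :: "nat \<Rightarrow> nat \<Rightarrow> (nat \<Rightarrow>\<^sub>0 nat) set" where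
  "box m n = {a. Poly_Mapping.keys a \<subseteq> {1..n} \<and> (\<forall>i. Poly_Mapping.lookup a i \<le> m)}"

lemma lookup_rev_comp: "Poly_Mapping.lookup (rev_comp m n a) i = (if i \<in> {1..n} then m - Poly_Mapping.lookup a (n + 1 - i) else 0)"
  by transfer simp

lemma box_le: "a \<in> box m n \<Longrightarrow> Poly_Mapping.lookup a i \<le> m"
  by (simp add: box_def)

lemma box_outside: "a \<in> box m n \<Longrightarrow> i \<notin> {1..n} \<Longrightarrow> Poly_Mapping.lookup a i = 0"
  by (auto simp: box_def in_keys_iff subset_iff)

lemma boxI:
  assumes "\<And>i. i \<notin> {1..n} \<Longrightarrow> Poly_Mapping.lookup a i = 0" "\<And>i. i \<in> {1..n} \<Longrightarrow> Poly_Mapping.lookup a i \<le> m"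
  shows "a \<in> box m n"
proof -
  have "Poly_Mapping.lookup a i \<le> m" for i using assms by (cases "i \<in> {1..n}") auto
  moreover have "Poly_Mapping.keys a \<subseteq> {1..n}" using assms(1) by (metis in_keys_iff subsetI)
  ultimately show ?thesis by (simp add: box_def)
qed

lemma rev_comp_involutory:
  assumes "a \<in> box m n"
  shows "rev_comp m n (rev_comp m n a) = a"
proof (rule poly_mapping_eqI)
  fix i
  show "Poly_Mapping.lookup (rev_comp m n (rev_comp m n a)) i = Poly_Mapping.lookup a i"
    using box_le[OF assms, of i] box_outside[OF assms, of i] by (auto simp: lookup_rev_comp)
qed

lemma swap_comp_box:
  assumes "a \<in> box m n" "1 \<le> i" "i < n"
  shows "swap_comp i a \<in> box m n"
proof (rule boxI)
  fix j assume "j \<notin> {1..n}"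
  then have "transpose i (i + 1) j = j" using assms(2,3) by (auto simp: transpose_def)
  then show "Poly_Mapping.lookup (swap_comp i a) j = 0"
    using box_outside[OF assms(1) \<open>j \<notin> {1..n}\<close>] by (simp add: lookup_swap_comp)
qed (simp add: lookup_swap_comp box_le[OF assms(1)])

text \<open>Reversal sends positions \<open>i\<close> and \<open>i + 1\<close> to
  \<open>n - i + 1\<close> and \<open>n - i\<close>.\<close>

lemma rev_comp_swap_comp:
  assumes "1 \<le> i" "i < n"
  shows "rev_comp m n (swap_comp i a) = swap_comp (n - i) (rev_comp m n a)"
proof (rule poly_mapping_eqI)
  fix j
  consider "j = n - i" | "j = n - i + 1" | "j \<noteq> n - i" "j \<noteq> n - i + 1" by blast
  then show "Poly_Mapping.lookup (rev_comp m n (swap_comp i a)) j = Poly_Mapping.lookup (swap_comp (n - i) (rev_comp m n a)) j"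
  proof cases
    case 1
    then show ?thesis using assms by (auto simp: lookup_rev_comp lookup_swap_comp Suc_diff_le)
  next
    case 2
    then show ?thesis using assms by (auto simp: lookup_rev_comp lookup_swap_comp)
  next
    case 3
    then have "j \<in> {1..n} \<Longrightarrow> transpose i (i + 1) (n + 1 - j) = n + 1 - j"
      using assms by (intro transpose_apply_other) auto
    then show ?thesis using 3 by (auto simp: lookup_rev_comp lookup_swap_comp)
  qed
qed

text \<open>A fraction-free form of \<open>rev_poly\<close>, additive on all polynomials and equal
  to it on those supported in the box.\<close>

definition rev_box :: "nat \<Rightarrow> nat \<Rightarrow> qpoly \<Rightarrow> qpoly" where
  "rev_box m n f = (\<Sum>a\<in>Poly_Mapping.keys f. Poly_Mapping.single (rev_comp m n a) (Poly_Mapping.lookup f a))"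

lemma rev_box_superset:
  assumes "finite A" "Poly_Mapping.keys f \<subseteq> A"
  shows "rev_box m n f = (\<Sum>a\<in>A. Poly_Mapping.single (rev_comp m n a) (Poly_Mapping.lookup f a))"
  unfolding rev_box_def using assms by (intro sum.mono_neutral_left) (auto simp: in_keys_iff)

lemma rev_box_single: "rev_box m n (Poly_Mapping.single a c) = Poly_Mapping.single (rev_comp m n a) c"
  by (subst rev_box_superset[of "{a}"]) auto

lemma rev_box_add: "rev_box m n (f + g) = rev_box m n f + rev_box m n g"
proof -
  let ?A = "Poly_Mapping.keys f \<union> Poly_Mapping.keys g"
  have "Poly_Mapping.keys (f + g) \<subseteq> ?A" by (rule keys_add)
  then show ?thesis
    by (simp add: rev_box_superset[of ?A] lookup_add single_add sum.distrib)
qed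

text \<open>Distinct exponent vectors in the box have distinct reversals, so no coefficients are
  merged and each can be read off again.\<close>

lemma lookup_rev_box:
  assumes "Poly_Mapping.keys f \<subseteq> box m n" "b \<in> box m n"
  shows "Poly_Mapping.lookup (rev_box m n f) (rev_comp m n b) = Poly_Mapping.lookup f b"
  using assms(1)
proof (induction rule: poly_mapping_induct_keys)
  case zero
  show ?case by (simp add: rev_box_def)
next
  case (monomial a c)
  then have "rev_comp m n a = rev_comp m n b \<longleftrightarrow> a = b"
    using rev_comp_involutory assms(2) by metis
  then show ?case by (simp add: rev_box_single lookup_single)
next
  case (add f g)
  then show ?case by (simp add: rev_box_add lookup_add)
qed

lemma rev_box_swap_poly:
  assumes "1 \<le> i" "i < n"
  shows "rev_box m n (swap_poly i f) = swap_poly (n - i) (rev_box m n f)"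
  by (induction f rule: poly_mapping_induct)
    (simp_all add: swap_poly_single rev_box_single rev_comp_swap_comp[OF assms] swap_poly_add rev_box_add)

lemma keys_swap_poly_box:
  assumes "Poly_Mapping.keys f \<subseteq> box m n" "1 \<le> i" "i < n"
  shows "Poly_Mapping.keys (swap_poly i f) \<subseteq> box m n"
  using assms(1)
proof (induction rule: poly_mapping_induct_keys)
  case zero
  show ?case using swap_poly_single[of i 0 0] by simp
next
  case (monomial a c)
  then show ?case using swap_comp_box[OF _ assms(2,3)] by (simp add: swap_poly_single)
next
  case (add f g)
  then show ?case using keys_add[of "swap_poly i f" "swap_poly i g"] by (auto simp: swap_poly_add)
qed

text \<open>Kept apart from the factor with exponents \<open>m\<close>, because without that factor
  the map is a ring homomorphism.\<close>

definition rev_subst :: "nat \<Rightarrow> qpoly \<Rightarrow> qpoly fract" where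
  "rev_subst n = substitute (\<lambda>c. to_fract (const c)) (\<lambda>i. inverse (to_fract (var (n + 1 - i))))"

lemma to_fract_var_nonzero: "to_fract (var i) \<noteq> 0"
  by (simp add: to_fract_eq_0_iff var_def mon_def) (metis lookup_single_eq lookup_zero zero_neq_one)

lemma to_fract_rev_comp:
  assumes "a \<in> box m n"
  shows "to_fract (mon (rev_comp m n a)) = (\<Prod>i\<in>{1..n}. to_fract (var i) ^ m) * rev_subst n (mon a)"
proof -
  let ?v = "\<lambda>i. to_fract (var i)"
  have flip: "(\<Prod>i\<in>{1..n}. g i) = (\<Prod>i\<in>{1..n}. g (n + 1 - i))" for g :: "nat \<Rightarrow> qpoly fract"
    by (rule prod.reindex_bij_witness[of _ "\<lambda>i. n + 1 - i" "\<lambda>i. n + 1 - i"]) auto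
  have "to_fract (mon (rev_comp m n a)) = (\<Prod>i\<in>{1..n}. ?v i ^ Poly_Mapping.lookup (rev_comp m n a) i)"
    by (subst mon_eq_prod[of "{1..n}"])
      (auto simp: to_fract_prod to_fract_power in_keys_iff lookup_rev_comp split: if_splits)
  also have "\<dots> = (\<Prod>i\<in>{1..n}. ?v (n + 1 - i) ^ (m - Poly_Mapping.lookup a i))"
    by (subst flip) (auto intro!: prod.cong simp: lookup_rev_comp)
  \<comment> \<open>The box bound makes \<open>m - lookup a i\<close> a true difference, so the
    power splits.\<close>
  also have "\<dots> = (\<Prod>i\<in>{1..n}. ?v (n + 1 - i) ^ m * inverse (?v (n + 1 - i)) ^ Poly_Mapping.lookup a i)"
    using assms to_fract_var_nonzero
    by (intro prod.cong) (auto simp: box_def power_diff_conv_inverse)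
  also have "\<dots> = (\<Prod>i\<in>{1..n}. ?v (n + 1 - i) ^ m) * (\<Prod>i\<in>{1..n}. inverse (?v (n + 1 - i)) ^ Poly_Mapping.lookup a i)"
    by (rule prod.distrib)
  also have "(\<Prod>i\<in>{1..n}. ?v (n + 1 - i) ^ m) = (\<Prod>i\<in>{1..n}. ?v i ^ m)"
    by (rule flip[symmetric])
  also have "(\<Prod>i\<in>{1..n}. inverse (?v (n + 1 - i)) ^ Poly_Mapping.lookup a i) = rev_subst n (mon a)"
    unfolding rev_subst_def using assms
    by (intro fract.substitute_mon_superset[symmetric]) (auto simp: box_def)
  finally show ?thesis .
qed

lemma to_fract_rev_box:
  assumes "Poly_Mapping.keys f \<subseteq> box m n"
  shows "to_fract (rev_box m n f) = (\<Prod>i\<in>{1..n}. to_fract (var i) ^ m) * rev_subst n f"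
  using assms
proof (induction rule: poly_mapping_induct_keys)
  case zero
  show ?case by (simp add: rev_box_def rev_subst_def fract.substitute_0 to_fract_0)
next
  case (monomial a c)
  then show ?case
    unfolding rev_box_single unfolding single_eq_const_mon
    by (simp add: to_fract_mult to_fract_rev_comp rev_subst_def
        fract.substitute_mult fract.substitute_const mult.left_commute)
next
  case (add f g)
  then show ?case
    by (simp add: rev_box_add to_fract_add rev_subst_def fract.substitute_add distrib_left)
qed

lemma rev_poly_eq_rev_box:
  assumes "Poly_Mapping.keys f \<subseteq> box m n"
  shows "rev_poly m n f = rev_box m n f"
  unfolding rev_poly_def
  using to_fract_rev_box[OF assms] unfolding rev_subst_def
  by (intro the_equality) (auto simp: to_fract_inject simp flip: to_fract_inject)

lemma rev_poly_inj:
  assumes "Poly_Mapping.keys f \<subseteq> box m n" "Poly_Mapping.keys g \<subseteq> box m n" "rev_poly m n f = rev_poly m n g"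
  shows "f = g"
proof (rule poly_mapping_eqI)
  fix b
  show "Poly_Mapping.lookup f b = Poly_Mapping.lookup g b"
  proof (cases "b \<in> box m n")
    case True
    then show ?thesis
      using assms lookup_rev_box[of f m n b] lookup_rev_box[of g m n b] by (simp add: rev_poly_eq_rev_box)
  next
    case False
    then have "b \<notin> Poly_Mapping.keys f" "b \<notin> Poly_Mapping.keys g" using assms by auto
    then show ?thesis by (simp add: in_keys_iff)
  qed
qed

text \<open>On a monomial, \<open>pihat i\<close> redistributes exponents only between
  \<open>i\<close> and \<open>i + 1\<close>, never above their maximum; \<open>i < n\<close> keeps
  both positions in range.\<close>

lemma keys_pihat_box:
  assumes "Poly_Mapping.keys f \<subseteq> box m n" "1 \<le> i" "i < n"
  shows "Poly_Mapping.keys (pihat i f) \<subseteq> box m n"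
  using assms(1)
proof (induction rule: poly_mapping_induct_keys)
  case zero
  show ?case using divdiff_const_mult[of i 0 0] by (simp add: pihat_def const_0)
next
  case (monomial a c)
  obtain g where g: "(var i - var (i + 1)) * g = mon a - swap_poly i (mon a)"
    and bounds: "\<And>b. b \<in> Poly_Mapping.keys (var i * var (i + 1) * g) \<Longrightarrow>
        (\<forall>j. j \<noteq> i \<longrightarrow> j \<noteq> i + 1 \<longrightarrow> Poly_Mapping.lookup b j = Poly_Mapping.lookup a j) \<and>
        Poly_Mapping.lookup b i \<le> max (Poly_Mapping.lookup a i) (Poly_Mapping.lookup a (i + 1)) \<and>
        Poly_Mapping.lookup b (i + 1) \<le> max (Poly_Mapping.lookup a i) (Poly_Mapping.lookup a (i + 1))"
    using divdiff_mon_exists[of i a] by blast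
  have "Poly_Mapping.keys (var i * var (i + 1) * g) \<subseteq> box m n"
  proof
    fix b assume "b \<in> Poly_Mapping.keys (var i * var (i + 1) * g)"
    note b = bounds[OF this]
    show "b \<in> box m n"
    proof (rule boxI)
      fix j assume "j \<notin> {1..n}"
      then have "j \<noteq> i" "j \<noteq> i + 1" using assms(2,3) by auto
      then show "Poly_Mapping.lookup b j = 0" using b box_outside[OF monomial \<open>j \<notin> {1..n}\<close>] by simp
    next
      fix j
      have "max (Poly_Mapping.lookup a i) (Poly_Mapping.lookup a (i + 1)) \<le> m" using box_le[OF monomial] by simp
      then show "Poly_Mapping.lookup b j \<le> m"
        using b box_le[OF monomial, of j] by (cases "j = i \<or> j = i + 1") auto
    qed
  qed
  moreover have "pihat i (Poly_Mapping.single a c) = const c * (var i * var (i + 1) * g)"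
    using divdiff_eqI[OF g] by (simp add: pihat_def single_eq_const_mon divdiff_const_mult mult_ac)
  moreover have "Poly_Mapping.keys (const c * h) \<subseteq> Poly_Mapping.keys h" for h
    using keys_mult[of "const c" h] by (cases "c = 0") (auto simp: const_def)
  ultimately show ?case by (metis subset_trans)
next
  case (add f g)
  then show ?case
    using keys_add[of "pihat i f" "pihat i g"] by (auto simp: pihat_def divdiff_add distrib_left)
qed

lemma rev_poly_pihat:
  assumes f: "Poly_Mapping.keys f \<subseteq> box m n" and i: "1 \<le> i" "i < n"
  shows "rev_poly m n (pihat i f) = divdiff (n - i) (rev_poly m n f)"
proof -
  define X where "X = (\<Prod>i\<in>{1..n}. to_fract (var i) ^ m)"
  define x y where "x = to_fract (var (n - i))" and "y = to_fract (var (n - i + 1))"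
  note rev = to_fract_rev_box[where m = m and n = n, folded X_def]
  have nz: "x \<noteq> 0" "y \<noteq> 0" by (simp_all add: x_def y_def to_fract_var_nonzero)
  have vars: "rev_subst n (var i) = inverse y" "rev_subst n (var (i + 1)) = inverse x"
    using i by (simp_all add: rev_subst_def fract.substitute_var x_def y_def Suc_diff_le)
  have "rev_subst n ((var i - var (i + 1)) * divdiff i f) = rev_subst n (f - swap_poly i f)"
    by (simp add: divdiff_mult[simplified])
  then have "(inverse y - inverse x) * rev_subst n (divdiff i f) = rev_subst n f - rev_subst n (swap_poly i f)"
    using vars by (simp add: rev_subst_def fract.substitute_mult fract.substitute_diff)
  moreover have "inverse y - inverse x = (x - y) * (inverse x * inverse y)"
    using nz by (simp add: field_simps)
  \<comment> \<open>The factor distinguishing \<open>pihat\<close> from \<open>divdiff\<close>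
    reverses to exactly the surplus factor in the difference of inverses and absorbs it.\<close>
  moreover have "rev_subst n (pihat i f) = inverse x * inverse y * rev_subst n (divdiff i f)"
    using vars by (simp add: pihat_def rev_subst_def fract.substitute_mult mult_ac)
  ultimately have "(x - y) * rev_subst n (pihat i f) = rev_subst n f - rev_subst n (swap_poly i f)"
    by (simp add: mult.assoc)
  \<comment> \<open>All three polynomials lie in the same box, so one factor \<open>X\<close> clears
    the denominators of all of them.\<close>
  then have "(x - y) * (X * rev_subst n (pihat i f)) = X * rev_subst n f - X * rev_subst n (swap_poly i f)"
    by (metis mult.left_commute right_diff_distrib')
  then have "to_fract ((var (n - i) - var (n - i + 1)) * rev_box m n (pihat i f))
      = to_fract (rev_box m n f - rev_box m n (swap_poly i f))"
    using rev[OF f] rev[OF keys_swap_poly_box[OF f i]] rev[OF keys_pihat_box[OF f i]]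
    by (simp add: to_fract_mult to_fract_diff x_def y_def)
  then have "divdiff (n - i) (rev_box m n f) = rev_box m n (pihat i f)"
    unfolding to_fract_inject rev_box_swap_poly[OF i] by (rule divdiff_eqI)
  then show ?thesis by (simp add: rev_poly_eq_rev_box f keys_pihat_box[OF f i])
qed

subsection \<open>Standardization\<close>

lemma increasing_tail_less:
  fixes w :: "nat \<Rightarrow> nat"
  assumes "\<forall>i\<ge>n. w i < w (i + 1)" "n \<le> i" "i < j"
  shows "w i < w j"
  using \<open>i < j\<close>
proof (induction j)
  case (Suc j)
  then have "w j < w (Suc j)" using assms(1,2) by simp
  with Suc show ?case by (cases "i = j") auto
qed simp

lemma increasing_tail_unique:
  fixes w v :: "nat \<Rightarrow> nat"
  assumes w: "w permutes {1..}" "\<forall>i\<ge>n + 1. w i < w (i + 1)"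
    and v: "v permutes {1..}" "\<forall>i\<ge>n + 1. v i < v (i + 1)"
    and eq: "\<forall>i\<in>{1..n}. w i = v i"
  shows "w = v"
proof
  fix i
  show "w i = v i"
  proof (induction i rule: less_induct)
    case (less i)
    \<comment> \<open>At a first disagreement, the smaller value \<open>p i\<close> must be taken by
      \<open>q\<close> somewhere: earlier contradicts injectivity of \<open>p\<close>, later
      contradicts the increasing tail of \<open>q\<close>. Stating it for \<open>p\<close> and
      \<open>q\<close> covers both orders.\<close>
    have no_less: False
      if that: "p permutes {1..}" "q permutes {1..}" "\<forall>i\<ge>n + 1. q i < q (i + 1)" "\<forall>i\<ge>n + 1. p i < p (i + 1)"
        "\<And>j. j < i \<Longrightarrow> p j = q j" "n + 1 \<le> i" "p i < q i" for p q :: "nat \<Rightarrow> nat"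
    proof -
      obtain j where j: "q j = p i" using permutes_surj[OF \<open>q permutes {1..}\<close>] by (metis surjD)
      consider "j < i" | "j = i" | "i < j" by linarith
      then show False
      proof cases
        case 1
        then have "p j = p i" using j that(5) by simp
        then show False using 1 permutes_inj[OF that(1)] by (auto simp: inj_eq)
      next
        case 3
        then show False using increasing_tail_less[OF that(3,6), of j] j that(7) by simp
      qed (use j that(7) in simp)
    qed
    consider "i = 0" | "i \<in> {1..n}" | "n + 1 \<le> i" by force
    then show ?case
    proof cases
      case 1
      then show ?thesis using w(1) v(1) by (simp add: permutes_def)
    next
      case 3
      then show ?thesis
        using no_less[OF w(1) v(1) v(2) w(2)] no_less[OF v(1) w(1) w(2) v(2)] less
        by (metis linorder_neqE_nat)
    qed (use eq in auto)
  qed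
qed

lemma increasing_tail_exists:
  fixes v :: "nat \<Rightarrow> nat"
  assumes inj: "inj_on v {1..n}" and sub: "v ` {1..n} \<subseteq> {1..M}"
  shows "\<exists>w. w permutes {1..M} \<and> (\<forall>i\<ge>n + 1. w i < w (i + 1)) \<and> (\<forall>i\<in>{1..n}. w i = v i)"
proof -
  define xs where "xs = sorted_list_of_set ({1..M} - v ` {1..n})"
  define w where "w i = (if i \<in> {1..n} then v i else if i \<in> {n + 1..M} then xs ! (i - n - 1) else i)" for i
  have xs: "set xs = {1..M} - v ` {1..n}" "distinct xs" "sorted_wrt (<) xs"
    by (simp_all add: xs_def)
  have len: "length xs = M - n"
    using inj sub by (simp add: xs_def card_Diff_subset card_image)
  have nM: "n \<le> M"
    using card_mono[OF _ sub] inj by (simp add: card_image)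
  have w_tail: "w i \<in> {1..M} - v ` {1..n}" if "i \<in> {n + 1..M}" for i
  proof -
    have "i - n - 1 < length xs" using that len by auto
    then show ?thesis using that nth_mem[of "i - n - 1" xs] xs(1) by (auto simp: w_def)
  qed
  have "inj_on w {1..M}"
  proof (rule inj_onI)
    fix i j assume ij: "i \<in> {1..M}" "j \<in> {1..M}" "w i = w j"
    have *: "w k \<in> v ` {1..n} \<longleftrightarrow> k \<in> {1..n}" if "k \<in> {1..M}" for k
      using w_tail[of k] that by (cases "k \<le> n") (auto simp: w_def)
    then have iff: "i \<in> {1..n} \<longleftrightarrow> j \<in> {1..n}" using ij by metis
    show "i = j"
    proof (cases "i \<in> {1..n}")
      case True
      then show ?thesis using ij(3) iff inj by (auto simp: w_def inj_on_eq_iff)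
    next
      case False
      then have "i - n - 1 = j - n - 1"
        using ij iff len xs(2) by (auto simp: w_def nth_eq_iff_index_eq)
      then show ?thesis using False ij iff by auto
    qed
  qed
  moreover have "w ` {1..M} \<subseteq> {1..M}"
  proof
    fix y assume "y \<in> w ` {1..M}"
    then obtain i where i: "i \<in> {1..M}" "y = w i" by blast
    show "y \<in> {1..M}"
    proof (cases "i \<in> {1..n}")
      case True
      then have "w i \<in> v ` {1..n}" by (simp add: w_def)
      then show ?thesis using sub i by blast
    next
      case False
      then show ?thesis using w_tail[of i] i by auto
    qed
  qed
  ultimately have "bij_betw w {1..M} {1..M}"
    by (simp add: bij_betw_def endo_inj_surj)
  then have "w permutes {1..M}"
    using nM by (rule_tac bij_imp_permutes) (auto simp: w_def)
  moreover have "w i < w (i + 1)" if i: "n + 1 \<le> i" for i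
  proof -
    consider "i + 1 \<le> M" | "i = M" | "M < i" by linarith
    then show ?thesis
    proof cases
      case 1
      then have "xs ! (i - n - 1) < xs ! (i - n)"
        using i len by (intro sorted_wrt_nth_less[OF xs(3)]) auto
      then show ?thesis using 1 i by (auto simp: w_def)
    next
      case 2
      then have "w i \<le> M" using w_tail[of i] i by auto
      then show ?thesis using 2 i by (simp add: w_def)
    qed (use i in \<open>auto simp: w_def\<close>)
  qed
  moreover have "\<forall>i\<in>{1..n}. w i = v i" by (simp add: w_def)
  ultimately show ?thesis by blast
qed

section \<open>Existence, uniqueness and swaps of standardizations\<close>

definition is_std :: "nat \<Rightarrow> nat \<Rightarrow> (nat \<Rightarrow>\<^sub>0 nat) \<Rightarrow> (nat \<Rightarrow> nat) \<Rightarrow> bool" where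
  "is_std m n \<alpha> w \<longleftrightarrow> (let \<beta> = Poly_Mapping.lookup (rev_comp (m + 1) n \<alpha>) in
     fin_perm w \<and> (\<forall>i\<ge>n + 1. w i < w (i + 1)) \<and>
     (\<forall>i\<in>{1..n}. (\<beta> i \<le> m \<longrightarrow> w i = \<beta> i) \<and>
        (\<beta> i = m + 1 \<longrightarrow> w i = m + card {j \<in> {1..i}. \<beta> j = m + 1})))"

lemma rev_comp_Suc_le: "Poly_Mapping.lookup (rev_comp (m + 1) n \<alpha>) i \<le> m + 1"
  by (simp add: lookup_rev_comp)

lemma is_std_unique:
  assumes "is_std m n \<alpha> w" "is_std m n \<alpha> v"
  shows "w = v"
proof (rule increasing_tail_unique)
  show "\<forall>i\<in>{1..n}. w i = v i"
  proof
    fix i assume "i \<in> {1..n}"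
    then show "w i = v i"
      using assms rev_comp_Suc_le[of m n \<alpha> i] unfolding is_std_def Let_def
      by (cases "Poly_Mapping.lookup (rev_comp (m + 1) n \<alpha>) i \<le> m") (simp_all add: le_Suc_eq)
  qed
qed (use assms in \<open>auto simp: is_std_def Let_def fin_perm_def\<close>)

lemma std_eqI: "is_std m n \<alpha> w \<Longrightarrow> std m n \<alpha> = w"
  using is_std_unique unfolding std_def is_std_def Let_def by (intro the_equality) blast+

text \<open>Position \<open>j\<close> counts itself. With \<open>i = 0\<close> this also shows that
  the count at a marked position is positive.\<close>

lemma card_prefix_less:
  assumes "i < j" "1 \<le> (j::nat)" "P j"
  shows "card {k \<in> {1..i}. P k} < card {k \<in> {1..j}. P k}"
proof (rule psubset_card_mono)
  have "j \<in> {k \<in> {1..j}. P k}" "j \<notin> {k \<in> {1..i}. P k}" using assms by auto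
  then show "{k \<in> {1..i}. P k} \<subset> {k \<in> {1..j}. P k}" using assms(1) by fastforce
qed simp

lemma is_std_exists:
  assumes \<alpha>: "\<alpha> \<in> box m n" and snowy: "snowy \<alpha>"
  shows "\<exists>w. is_std m n \<alpha> w"
proof -
  define \<beta> where "\<beta> = Poly_Mapping.lookup (rev_comp (m + 1) n \<alpha>)"
  define z where "z i = card {j \<in> {1..i}. \<beta> j = m + 1}" for i
  define v where "v i = (if \<beta> i \<le> m then \<beta> i else m + z i)" for i
  have \<beta>: "\<beta> i = m + 1 - Poly_Mapping.lookup \<alpha> (n + 1 - i)" "1 \<le> \<beta> i" "\<beta> i \<le> m + 1" if "i \<in> {1..n}" for i
    using that box_le[OF \<alpha>, of "n + 1 - i"] by (auto simp: \<beta>_def lookup_rev_comp)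
  have z_less: "z i < z j" if "i < j" "j \<in> {1..n}" "\<not> \<beta> j \<le> m" for i j
    unfolding z_def using that \<beta>(3)[OF that(2)] by (intro card_prefix_less) auto
  have z_pos: "1 \<le> z i" if "i \<in> {1..n}" "\<not> \<beta> i \<le> m" for i
    using z_less[of 0 i] that by auto
  have z_le: "z i \<le> n" if "i \<in> {1..n}" for i
  proof -
    have "z i \<le> card {1..i}" unfolding z_def by (rule card_mono) auto
    then show ?thesis using that by auto
  qed
  have "inj_on v {1..n}"
  proof (rule inj_onI)
    fix i j assume ij: "i \<in> {1..n}" "j \<in> {1..n}" "v i = v j"
    consider "\<beta> i \<le> m" "\<beta> j \<le> m" | "\<not> \<beta> i \<le> m" "\<not> \<beta> j \<le> m"
      | "\<beta> i \<le> m" "\<not> \<beta> j \<le> m" | "\<not> \<beta> i \<le> m" "\<beta> j \<le> m" by blast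
    then show "i = j"
    proof cases
      case 1
      let ?i = "n + 1 - i" and ?j = "n + 1 - j"
      \<comment> \<open>\<open>\<beta> i \<le> m\<close> says that the corresponding entry of
        \<open>\<alpha>\<close> is positive, which is where snowiness gives injectivity.\<close>
      have "?i \<in> Poly_Mapping.keys \<alpha>" "?j \<in> Poly_Mapping.keys \<alpha>" "Poly_Mapping.lookup \<alpha> ?i = Poly_Mapping.lookup \<alpha> ?j"
        using 1 ij(3) \<beta>(1)[OF ij(1)] \<beta>(1)[OF ij(2)] box_le[OF \<alpha>, of ?i] box_le[OF \<alpha>, of ?j]
        unfolding in_keys_iff v_def by presburger+
      then have "?i = ?j" using snowy by (auto simp: snowy_def inj_on_def)
      then show ?thesis using ij by auto
    next
      case 2
      then have "z i = z j" using ij by (simp add: v_def)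
      then show ?thesis using z_less[of i j] z_less[of j i] ij 2 by (metis less_irrefl linorder_neqE_nat)
    qed (use ij z_pos[OF ij(1)] z_pos[OF ij(2)] in \<open>auto simp: v_def\<close>)
  qed
  \<comment> \<open>There are at most \<open>n\<close> zero entries to be numbered above
    \<open>m\<close>, whence the bound \<open>m + n\<close>.\<close>
  moreover have "v ` {1..n} \<subseteq> {1..m + n}"
  proof
    fix y assume "y \<in> v ` {1..n}"
    then obtain i where i: "i \<in> {1..n}" "y = v i" by blast
    then show "y \<in> {1..m + n}"
      using \<beta>(2)[OF i(1)] z_pos[OF i(1)] z_le[OF i(1)] by (auto simp: v_def)
  qed
  ultimately obtain w where w: "w permutes {1..m + n}" "\<forall>i\<ge>n + 1. w i < w (i + 1)" "\<forall>i\<in>{1..n}. w i = v i"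
    using increasing_tail_exists by blast
  have "is_std m n \<alpha> w"
    unfolding is_std_def Let_def \<beta>_def[symmetric] z_def[symmetric]
    using w fin_perm_iff by (auto simp: v_def)
  then show ?thesis by blast
qed

lemma is_std_std: "\<alpha> \<in> box m n \<Longrightarrow> snowy \<alpha> \<Longrightarrow> is_std m n \<alpha> (std m n \<alpha>)"
  using is_std_exists std_eqI by metis

lemma is_std_values:
  assumes "is_std m n \<alpha> w" "i \<in> {1..n}"
  shows "w i = Poly_Mapping.lookup (rev_comp (m + 1) n \<alpha>) i \<and> w i \<le> m \<or>
    Poly_Mapping.lookup (rev_comp (m + 1) n \<alpha>) i = m + 1 \<and>
      w i = m + card {j \<in> {1..i}. Poly_Mapping.lookup (rev_comp (m + 1) n \<alpha>) j = m + 1} \<and> m + 1 \<le> w i"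
proof -
  let ?\<beta> = "Poly_Mapping.lookup (rev_comp (m + 1) n \<alpha>)"
  have "?\<beta> i = m + 1 \<Longrightarrow> 0 < card {j \<in> {1..i}. ?\<beta> j = m + 1}"
    using card_prefix_less[of 0 i "\<lambda>j. ?\<beta> j = m + 1"] assms(2) by simp
  then show ?thesis
    using assms rev_comp_Suc_le[of m n \<alpha> i] by (auto simp: is_std_def Let_def le_Suc_eq)
qed

text \<open>The entry at \<open>i + 1\<close> is positive, so with \<open>p = n - i\<close> the
  value at \<open>p\<close> is at most \<open>m\<close>. At most one of the swapped positions stands
  for a zero, and the zeros keep their relative order and numbering.\<close>

lemma is_std_swap_comp:
  assumes \<alpha>: "\<alpha> \<in> box m n" and i: "1 \<le> i" "i < n" and asc: "Poly_Mapping.lookup \<alpha> i < Poly_Mapping.lookup \<alpha> (i + 1)"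
    and w: "is_std m n \<alpha> w"
  shows "is_std m n (swap_comp i \<alpha>) (w \<circ> transpose (n - i) (n - i + 1))" "w (n - i) < w (n - i + 1)"
proof -
  define p where "p = n - i"
  let ?\<beta> = "Poly_Mapping.lookup (rev_comp (m + 1) n \<alpha>)"
  let ?t = "transpose p (p + 1)"
  have p: "1 \<le> p" "p < n" using i by (auto simp: p_def)
  have t: "?t j \<in> {1..n} \<longleftrightarrow> j \<in> {1..n}" "n + 1 \<le> j \<Longrightarrow> ?t j = j" for j
    using p by (auto simp: transpose_def)
  have \<beta>': "Poly_Mapping.lookup (rev_comp (m + 1) n (swap_comp i \<alpha>)) j = ?\<beta> (?t j)" for j
    using i by (simp add: rev_comp_swap_comp lookup_swap_comp p_def)
  have "?\<beta> p = m + 1 - Poly_Mapping.lookup \<alpha> (i + 1)" "?\<beta> (p + 1) = m + 1 - Poly_Mapping.lookup \<alpha> i"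
    using i by (simp_all add: lookup_rev_comp p_def Suc_diff_le)
  then have \<beta>p: "?\<beta> p \<le> m" "?\<beta> p < ?\<beta> (p + 1)"
    using asc box_le[OF \<alpha>, of "i + 1"] by auto
  have "p \<in> {1..n}" "p + 1 \<in> {1..n}" using p by auto
  from is_std_values[OF w this(1)] is_std_values[OF w this(2)] \<beta>p
  show "w (n - i) < w (n - i + 1)" by (auto simp: p_def)
  have card_eq: "card {k \<in> {1..?t j}. ?\<beta> k = m + 1} = card {k \<in> {1..j}. ?\<beta> (?t k) = m + 1}"
    if "?\<beta> (?t j) = m + 1" for j
  proof -
    \<comment> \<open>The prefix up to \<open>p\<close> is the only one whose marked positions the
      swap can change; \<open>j = p + 1\<close> would make the unmarked \<open>p\<close> the
      image.\<close>
    have "j \<noteq> p + 1" using that \<beta>p by auto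
    have "{k \<in> {1..?t j}. ?\<beta> k = m + 1} = ?t ` {k \<in> {1..j}. ?\<beta> (?t k) = m + 1}"
    proof (rule set_eqI)
      fix k
      have "?\<beta> k = m + 1 \<Longrightarrow> k \<in> {1..?t j} \<longleftrightarrow> ?t k \<in> {1..j}"
        using \<open>j \<noteq> p + 1\<close> \<beta>p p by (auto simp: transpose_def)
      then show "k \<in> {k \<in> {1..?t j}. ?\<beta> k = m + 1} \<longleftrightarrow> k \<in> ?t ` {k \<in> {1..j}. ?\<beta> (?t k) = m + 1}"
        unfolding in_transpose_image_iff by auto
    qed
    then show ?thesis by (simp add: card_image)
  qed
  obtain N where N: "w permutes {1..N}" using w by (auto simp: is_std_def Let_def fin_perm_iff)
  then have "w permutes {1..N + n}" by (rule permutes_subset) auto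
  then have "fin_perm (w \<circ> ?t)"
    using permutes_comp_transpose[of w "N + n" p] p fin_perm_iff by auto
  moreover have "\<forall>j\<ge>n + 1. (w \<circ> ?t) j < (w \<circ> ?t) (j + 1)"
    using w t(2) by (simp add: is_std_def Let_def)
  moreover have "\<forall>j\<in>{1..n}. (?\<beta> (?t j) \<le> m \<longrightarrow> (w \<circ> ?t) j = ?\<beta> (?t j)) \<and>
      (?\<beta> (?t j) = m + 1 \<longrightarrow> (w \<circ> ?t) j = m + card {k \<in> {1..j}. ?\<beta> (?t k) = m + 1})"
  proof
    fix j assume "j \<in> {1..n}"
    then have "?t j \<in> {1..n}" using t by blast
    then show "(?\<beta> (?t j) \<le> m \<longrightarrow> (w \<circ> ?t) j = ?\<beta> (?t j)) \<and>
      (?\<beta> (?t j) = m + 1 \<longrightarrow> (w \<circ> ?t) j = m + card {k \<in> {1..j}. ?\<beta> (?t k) = m + 1})"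
      using w card_eq[of j] unfolding is_std_def Let_def by simp
  qed
  ultimately show "is_std m n (swap_comp i \<alpha>) (w \<circ> transpose (n - i) (n - i + 1))"
    unfolding is_std_def Let_def \<beta>' p_def[symmetric] by blast
qed

lemma is_partition_antimono:
  assumes "is_partition \<alpha>" "1 \<le> i" "i \<le> j"
  shows "Poly_Mapping.lookup \<alpha> j \<le> Poly_Mapping.lookup \<alpha> i"
  using assms(3)
proof (induction j rule: dec_induct)
  case (step j)
  then have "Poly_Mapping.lookup \<alpha> (Suc j) \<le> Poly_Mapping.lookup \<alpha> j" using assms(1,2) by (simp add: is_partition_def)
  then show ?case using step by simp
qed simp

text \<open>Here \<open>\<beta>\<close> decreases weakly, so \<open>w\<close> starts with
  \<open>m + 1, m + 2, ...\<close> for the zeros and then decreases strictly up to position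
  \<open>n\<close>. The smaller values to the right of \<open>i\<close> are exactly those from 1 to
  \<open>\<beta> i - 1\<close>; this subtraction turns \<open>m + 1\<close> into
  \<open>m\<close>.\<close>

lemma invcode_std_partition:
  assumes \<alpha>: "\<alpha> \<in> box m n" and part: "is_partition \<alpha>" and std: "is_std m n \<alpha> w"
  shows "invcode w = rev_comp m n \<alpha>"
proof (rule poly_mapping_eqI)
  fix i
  let ?\<beta> = "Poly_Mapping.lookup (rev_comp (m + 1) n \<alpha>)"
  obtain N where w: "w permutes {1..N}" using std by (auto simp: is_std_def Let_def fin_perm_iff)
  have "w permutes {1..}" by (rule permutes_subset[OF w]) auto
  have tail: "\<forall>i\<ge>n + 1. w i < w (i + 1)" using std by (simp add: is_std_def Let_def)
  have \<beta>_le: "?\<beta> k \<le> ?\<beta> j" if "1 \<le> j" "j \<le> k" "k \<le> n" for j k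
    using is_partition_antimono[OF part, of "n + 1 - k" "n + 1 - j"] that
    by (simp add: lookup_rev_comp diff_le_mono2)
  show "Poly_Mapping.lookup (invcode w) i = Poly_Mapping.lookup (rev_comp m n \<alpha>) i"
  proof (cases "i \<in> {1..n}")
    case False
    have "inversions_below w i = {}"
    proof (cases "i = 0")
      case True
      then show ?thesis using w by (simp add: inversions_below_def permutes_def)
    next
      case False
      with \<open>i \<notin> {1..n}\<close> have "n + 1 \<le> i" by auto
      from increasing_tail_less[OF tail this] show ?thesis
        by (auto simp: inversions_below_def dest: less_asym)
    qed
    then show ?thesis using False w by (auto simp: lookup_invcode_permutes lookup_rev_comp)
  next
    case True
    note val = is_std_values[OF std]
    have "inversions_below w i = w -` {1..<?\<beta> i}"
    proof (rule set_eqI)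
      fix j
      show "j \<in> inversions_below w i \<longleftrightarrow> j \<in> w -` {1..<?\<beta> i}"
      proof
        assume "j \<in> inversions_below w i"
        then have j: "i < j" "w j < w i" by (auto simp: inversions_below_def)
        then have "1 \<le> w j" using permutes_in_image[OF \<open>w permutes {1..}\<close>, of j] by auto
        moreover have "w j < ?\<beta> i"
        proof (cases "?\<beta> i = m + 1")
          case top: True
          \<comment> \<open>All positions up to \<open>i\<close> stand for zeros and use up the
            values \<open>m + 1\<close> to \<open>m + i\<close>, so a smaller value further right is
            at most \<open>m\<close>.\<close>
          have wk: "w k = m + k" if "k \<in> {1..i}" for k
          proof -
            have "?\<beta> l = m + 1" if "l \<in> {1..i}" for l
              using \<beta>_le[of l i] that True top rev_comp_Suc_le[of m n \<alpha> l] by auto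
            then have "{l \<in> {1..k}. ?\<beta> l = m + 1} = {1..k}" "?\<beta> k = m + 1"
              using that by auto
            then show ?thesis using val[of k] that True by auto
          qed
          show ?thesis
          proof (rule ccontr)
            assume "\<not> w j < ?\<beta> i"
            then obtain k where k: "w j = m + k" "1 \<le> k" using top
              by (metis le_Suc_ex linorder_not_less add.assoc le_add1)
            then have "k \<in> {1..i}" using j(2) wk[of i] True by auto
            then have "w k = w j" using wk k by simp
            then have "k = j" using permutes_inj[OF w] by (auto simp: inj_eq)
            then show False using \<open>k \<in> {1..i}\<close> j(1) by simp
          qed
        qed (use val[OF True] j in auto)
        ultimately show "j \<in> w -` {1..<?\<beta> i}" by simp
      next
        assume "j \<in> w -` {1..<?\<beta> i}"
        then have j: "1 \<le> w j" "w j < ?\<beta> i" by auto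
        then have "w j \<le> m" using rev_comp_Suc_le[of m n \<alpha> i] by simp
        then have "w j < w i" using val[OF True] j by auto
        moreover have "i < j"
        proof (rule ccontr)
          assume "\<not> i < j"
          moreover have "1 \<le> j" using permutes_in_image[OF \<open>w permutes {1..}\<close>, of j] j by auto
          ultimately have "?\<beta> i \<le> ?\<beta> j" "j \<in> {1..n}" using \<beta>_le[of j i] True by auto
          then show False using val[of j] j \<open>w j \<le> m\<close> by auto
        qed
        ultimately show "j \<in> inversions_below w i" by (simp add: inversions_below_def)
      qed
    qed
    then have "card (inversions_below w i) = ?\<beta> i - 1"
      using card_vimage_inj[of w "{1..<?\<beta> i}"] permutes_inj[OF w] permutes_surj[OF w] by simp
    then show ?thesis using w True by (auto simp: lookup_invcode_permutes lookup_rev_comp)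
  qed
qed

lemma is_partition_rev_comp:
  assumes "is_partition \<alpha>"
  shows "is_partition (rev_comp m n \<alpha>)"
  unfolding is_partition_def
proof (intro allI impI)
  fix i :: nat assume "1 \<le> i"
  then show "Poly_Mapping.lookup (rev_comp m n \<alpha>) (i + 1) \<le> Poly_Mapping.lookup (rev_comp m n \<alpha>) i"
    using is_partition_antimono[OF assms, of "n - i" "n + 1 - i"] by (auto simp: lookup_rev_comp diff_le_mono2)
qed

subsection \<open>Top Lascoux polynomials\<close>

lemma snowy_swap_comp: "snowy (swap_comp i \<alpha>) \<longleftrightarrow> snowy \<alpha>"
proof -
  have imp: "snowy (swap_comp i \<beta>)" if "snowy \<beta>" for \<beta>
    using that unfolding snowy_def keys_swap_comp
    by (auto simp: inj_on_def lookup_swap_comp)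
  moreover have "swap_comp i (swap_comp i \<alpha>) = \<alpha>"
    by (intro poly_mapping_eqI) (simp add: lookup_swap_comp)
  ultimately show ?thesis by metis
qed

text \<open>Stated for every derivable \<open>f\<close>, since uniqueness of \<open>f\<close> is to
  be deduced from it. The key bound is carried along for \<open>rev_poly_pihat\<close>; snowiness
  comes from the base rule and survives swaps.\<close>

lemma is_top_lascoux_rev:
  assumes "is_top_lascoux \<alpha> f" "\<alpha> \<in> box m n"
  shows "snowy \<alpha> \<and> Poly_Mapping.keys f \<subseteq> box m n \<and> is_schubert (std m n \<alpha>) (rev_poly m n f)"
  using assms
proof (induction rule: is_top_lascoux.induct)
  case (partition \<alpha>)
  let ?w = "std m n \<alpha>"
  have std: "is_std m n \<alpha> ?w" using partition by (intro is_std_std)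
  have keys: "Poly_Mapping.keys (mon \<alpha>) \<subseteq> box m n" using partition by (simp add: mon_def)
  have code: "invcode ?w = rev_comp m n \<alpha>"
    using invcode_std_partition partition std by blast
  have "rev_poly m n (mon \<alpha>) = mon (invcode ?w)"
    unfolding rev_poly_eq_rev_box[OF keys] code by (simp add: mon_def rev_box_single)
  moreover have "dominant ?w"
    unfolding dominant_def code using partition(3) by (rule is_partition_rev_comp)
  moreover have "fin_perm ?w" using std by (simp add: is_std_def Let_def)
  ultimately show ?case using partition keys by (auto intro: is_schubert.dominant)
next
  case (ascent i \<alpha> f)
  \<comment> \<open>The upper entry of an ascent is positive and so lies in the support.\<close>
  have "i + 1 \<in> {1..n}" using ascent(2) box_outside[OF ascent.prems, of "i + 1"] by auto
  then have i: "1 \<le> i" "i < n" using ascent(1) by auto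
  have IH: "snowy \<alpha>" "Poly_Mapping.keys f \<subseteq> box m n" "is_schubert (std m n (swap_comp i \<alpha>)) (rev_poly m n f)"
    using ascent.IH swap_comp_box[OF ascent.prems i] by (auto simp: snowy_swap_comp)
  have std: "is_std m n \<alpha> (std m n \<alpha>)" using is_std_std ascent.prems IH(1) .
  note swap = is_std_swap_comp[OF ascent.prems i ascent(2) std]
  have "is_schubert (std m n \<alpha>) (divdiff (n - i) (rev_poly m n f))"
    using i swap(2) IH(3) unfolding std_eqI[OF swap(1)] by (intro is_schubert.ascent) auto
  then show ?case
    using IH keys_pihat_box[OF IH(2) i] rev_poly_pihat[OF IH(2) i] by simp
qed

text \<open>Swapping ascents sorts \<open>\<alpha>\<close> towards a partition. No ascent occurs at
  \<open>n\<close> or later, where the next entry is 0.\<close>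

lemma is_top_lascoux_exists:
  assumes "\<alpha> \<in> box m n" "snowy \<alpha>"
  shows "\<exists>f. is_top_lascoux \<alpha> f"
  using assms
proof (induction "\<Sum>k\<in>{1..n}. k * Poly_Mapping.lookup \<alpha> k" arbitrary: \<alpha> rule: less_induct)
  case less
  show ?case
  proof (cases "\<exists>i\<ge>1. i < n \<and> Poly_Mapping.lookup \<alpha> i < Poly_Mapping.lookup \<alpha> (i + 1)")
    case True
    then obtain i where i: "1 \<le> i" "i < n" "Poly_Mapping.lookup \<alpha> i < Poly_Mapping.lookup \<alpha> (i + 1)" by blast
    then have "\<exists>f. is_top_lascoux (swap_comp i \<alpha>) f"
      using weighted_sum_comp_transpose_less[OF i] less.prems swap_comp_box[OF less.prems(1) i(1,2)]
      by (intro less.hyps) (simp_all add: lookup_swap_comp snowy_swap_comp)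
    then show ?thesis using i is_top_lascoux.ascent by blast
  next
    case False
    have "is_partition \<alpha>"
      unfolding is_partition_def
    proof (intro allI impI)
      fix i :: nat assume "1 \<le> i"
      show "Poly_Mapping.lookup \<alpha> (i + 1) \<le> Poly_Mapping.lookup \<alpha> i"
        using False \<open>1 \<le> i\<close> box_outside[OF less.prems(1), of "i + 1"] by (cases "i < n") auto
    qed
    moreover have "0 \<notin> Poly_Mapping.keys \<alpha>" using less.prems(1) by (auto simp: box_def)
    ultimately show ?thesis using less.prems(2) is_top_lascoux.partition by blast
  qed
qed

theorem theorem3p6:
  fixes \<alpha> :: "nat \<Rightarrow>\<^sub>0 nat" and m n :: nat
  assumes "snowy \<alpha>"
    and "m \<ge> 1" and "n \<ge> 1"
    and "Poly_Mapping.keys \<alpha> \<subseteq> {1..n}"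
    and "m \<ge> Max (range (Poly_Mapping.lookup \<alpha>))"
  shows "rev_poly m n (top_lascoux \<alpha>) = schubert (std m n \<alpha>)"
proof -
  \<comment> \<open>The bound through \<open>Max\<close> speaks about all entries only because a
    finitely supported function has finite range.\<close>
  have "finite (range (Poly_Mapping.lookup \<alpha>))"
    by (rule finite_subset[of _ "insert 0 (Poly_Mapping.lookup \<alpha> ` Poly_Mapping.keys \<alpha>)"]) (auto simp: in_keys_iff)
  then have "Poly_Mapping.lookup \<alpha> i \<le> m" for i
    using assms(5) by (meson Max_ge order_trans rangeI)
  then have \<alpha>: "\<alpha> \<in> box m n" using assms(4) by (simp add: box_def)
  obtain f where f: "is_top_lascoux \<alpha> f"
    using is_top_lascoux_exists[OF \<alpha> assms(1)] by blast
  note rev = is_top_lascoux_rev[OF _ \<alpha>]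
  have "top_lascoux \<alpha> = f"
    unfolding top_lascoux_def
  proof (rule the_equality)
    fix g assume "is_top_lascoux \<alpha> g"
    with f show "g = f"
      using rev is_schubert_unique rev_poly_inj by metis
  qed (rule f)
  then show ?thesis using rev[OF f] schubert_eqI by metis
qed

end
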